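(* Let $I$ be a (small) set, let $(\mathcal A_i)_{i\in I}$ be a family of nonempty categories, and for each $i\in I$ let $S_i\subseteq\mathsf{Mor}(\mathcal A_i)$ be a class of morphisms containing all identity morphisms of $\mathcal A_i$. Let $$\Theta:\Big(\prod_{i\in I}\mathcal A_i\Big)\Big[\Big(\prod_{i\in I}S_i\Big)^{-1}\Big]\longrightarrow\prod_{i\in I}\mathcal A_i[S_i^{-1}]$$ be the canonical functor induced by the universal property of localization. Then $\Theta$ is faithful if and only if, for every $L\in\mathbb N$, there exist a finite subset $F_L\subseteq I$ and $D_L\in\mathbb N$ such that $d_i(L)\leq D_L$ for every $i\in I\setminus F_L$.
   Context: Size issues are ignored (or handled by universes); localizations always exist. For a category $\mathcal A$ and a class $S\subseteq\mathsf{Mor}(\mathcal A)$, the Gabriel--Zisman localization $Q:\mathcal A\to\mathcal A[S^{-1}]$ sends every morphism of $S$ to an isomorphism, and every functor out of $\mathcal A$ sending $S$ to isomorphisms factors uniquely (on the nose) through $Q$. Explicit model. Regard the morphisms of $\mathcal A$ as mere arrows with source and target. Let $\overline S=\{\overline s:Y\to X\mid (s:X\to Y)\in S\}$ be a class of new formal arrows. $\langle\mathsf{Mor}(\mathcal A)\sqcup\overline S\rangle$ is the class of all finite formal compositions (nonempty words $a_m\ast\cdots\ast a_1$ of composable arrows) of arrows in the disjoint union $\mathsf{Mor}(\mathcal A)\sqcup\overline S$; $\ast$ denotes formal composition. For such a word $\mathfrak P$, $|\mathfrak P|$ is its number of arrows. An elementary rewriting is one of the following replacements, in either direction, where $f:X\to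 Y$, $g:Y\to Z$ are in $\mathsf{Mor}(\mathcal A)$, $a:M\to N$ is in $\mathsf{Mor}(\mathcal A)\sqcup\overline S$, $s:X\to Y$ is in $S$, and $\mathfrak U,\mathfrak V$ are words (either or both possibly omitted) for which the expressions are defined: (1) $\mathfrak U\ast(g\ast f)\ast\mathfrak V\leftrightarrow\mathfrak U\ast(g\circ f)\ast\mathfrak V$; (2) $\mathfrak U\ast(\operatorname{Id}_N\ast a)\ast\mathfrak V\leftrightarrow\mathfrak U\ast a\ast\mathfrak V$; (3) $\mathfrak U\ast(a\ast\operatorname{Id}_M)\ast\mathfrak V\leftrightarrow\mathfrak U\ast a\ast\mathfrak V$; (4) $\mathfrak U\ast(s\ast\overline s)\ast\mathfrak V\leftrightarrow\mathfrak U\ast\operatorname{Id}_Y\ast\mathfrak V$; (5) $\mathfrak U\ast(\overline s\ast s)\ast\mathfrak V\leftrightarrow\mathfrak U\ast\operatorname{Id}_X\ast\mathfrak V$. Two words are equivalent if they are connected by finitely many elementary rewritings. $\mathcal A[S^{-1}]$ has the objects of $\mathcal A$, its morphisms $X\to Y$ are the equivalence classes $[\mathfrak P]$ of words from $X$ to $Y$, and composition is induced by $\ast$. For words with $[\mathfrak P]=[\mathfrak Q]$, $\delta(\mathfrak P,\mathfrak Q)\in\mathbb N$ is the least number of elementary rewriting steps needed to rewrite $\mathfrak P$ as $\mathfrak Q$. For $i\in I$ and $L\in\mathbb N$, $$d_i(L)=\sup\{\delta(\mathfrak P,\mathfrak Q)\mid \mathfrak P,\mathfrak Q\in\langle\mathsf{Mor}(\mathcal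 A_i)\sqcup\overline{S_i}\rangle,\ [\mathfrak P]=[\mathfrak Q],\ |\mathfrak P|\leq L,\ |\mathfrak Q|\leq L\}\in\mathbb N\cup\{\infty\},$$ computed with respect to $(\mathcal A_i,S_i)$, the supremum of the empty set being $0$. The class $\prod_{i\in I}S_i$ consists of the morphisms $(s_i)_{i\in I}$ of $\prod_{i\in I}\mathcal A_i$ with $s_i\in S_i$ for all $i$. If $Q_i:\mathcal A_i\to\mathcal A_i[S_i^{-1}]$ are the localizations, $\Theta$ is the unique functor whose composite with the localization functor of $\prod_i\mathcal A_i$ at $\prod_i S_i$ equals $\prod_{i}Q_i$. *)

theory Defs
  imports "HOL-Library.FuncSet" "HOL-Library.Extended_Nat"
begin

section \<open>Categories and functors\<close>

record ('o, 'm) cat =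
  Obj :: "'o set"
  Mor :: "'m set"
  source :: "'m \<Rightarrow> 'o"
  target :: "'m \<Rightarrow> 'o"
  ident :: "'o \<Rightarrow> 'm"
  cmp :: "'m \<Rightarrow> 'm \<Rightarrow> 'm"

text \<open>\<open>cmp C g f\<close> is the composite of \<open>f\<close> followed by \<open>g\<close>. The operations of a record matter only
  on \<open>Obj C\<close>, \<open>Mor C\<close> and composable pairs; their values elsewhere are arbitrary.\<close>

locale category =
  fixes C :: "('o, 'm) cat"
  assumes source_in: "f \<in> Mor C \<Longrightarrow> source C f \<in> Obj C"
    and target_in: "f \<in> Mor C \<Longrightarrow> target C f \<in> Obj C"
    and ident_in: "X \<in> Obj C \<Longrightarrow> ident C X \<in> Mor C"
    and source_ident: "X \<in> Obj C \<Longrightarrow> source C (ident C X) = X"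
    and target_ident: "X \<in> Obj C \<Longrightarrow> target C (ident C X) = X"
    and cmp_in: "\<lbrakk>f \<in> Mor C; g \<in> Mor C; source C g = target C f\<rbrakk> \<Longrightarrow> cmp C g f \<in> Mor C"
    and source_cmp:
      "\<lbrakk>f \<in> Mor C; g \<in> Mor C; source C g = target C f\<rbrakk> \<Longrightarrow> source C (cmp C g f) = source C f"
    and target_cmp:
      "\<lbrakk>f \<in> Mor C; g \<in> Mor C; source C g = target C f\<rbrakk> \<Longrightarrow> target C (cmp C g f) = target C g"
    and ident_cmp: "f \<in> Mor C \<Longrightarrow> cmp C (ident C (target C f)) f = f"
    and cmp_ident: "f \<in> Mor C \<Longrightarrow> cmp C f (ident C (source C f)) = f"
    and cmp_assoc:
      "\<lbrakk>f \<in> Mor C; g \<in> Mor C; h \<in> Mor C; source C g = target C f; source C h = target C g\<rbrakk>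
        \<Longrightarrow> cmp C h (cmp C g f) = cmp C (cmp C h g) f"

record ('o1, 'm1, 'o2, 'm2) ftor =
  FObj :: "'o1 \<Rightarrow> 'o2"
  FMor :: "'m1 \<Rightarrow> 'm2"

text \<open>The two maps of a functor are extensional (\<open>undefined\<close> outside the objects and morphisms of
  its domain), so that equality of functors is equality of records.\<close>

definition is_functor ::
  "('o1, 'm1) cat \<Rightarrow> ('o2, 'm2) cat \<Rightarrow> ('o1, 'm1, 'o2, 'm2) ftor \<Rightarrow> bool" where
  "is_functor C D F \<longleftrightarrow>
     FObj F \<in> Obj C \<rightarrow>\<^sub>E Obj D \<and>
     FMor F \<in> Mor C \<rightarrow>\<^sub>E Mor D \<and>
     (\<forall>f\<in>Mor C. source D (FMor F f) = FObj F (source C f)) \<and>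
     (\<forall>f\<in>Mor C. target D (FMor F f) = FObj F (target C f)) \<and>
     (\<forall>X\<in>Obj C. FMor F (ident C X) = ident D (FObj F X)) \<and>
     (\<forall>f\<in>Mor C. \<forall>g\<in>Mor C. source C g = target C f \<longrightarrow>
        FMor F (cmp C g f) = cmp D (FMor F g) (FMor F f))"

definition functor_comp ::
  "('o1, 'm1) cat \<Rightarrow> ('o2, 'm2, 'o3, 'm3) ftor \<Rightarrow> ('o1, 'm1, 'o2, 'm2) ftor
    \<Rightarrow> ('o1, 'm1, 'o3, 'm3) ftor" where
  "functor_comp C G F =
     \<lparr>FObj = compose (Obj C) (FObj G) (FObj F), FMor = compose (Mor C) (FMor G) (FMor F)\<rparr>"

definition faithful :: "('o1, 'm1) cat \<Rightarrow> ('o1, 'm1, 'o2, 'm2) ftor \<Rightarrow> bool" where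
  "faithful C F \<longleftrightarrow>
     (\<forall>f\<in>Mor C. \<forall>g\<in>Mor C. source C f = source C g \<longrightarrow> target C f = target C g \<longrightarrow>
        FMor F f = FMor F g \<longrightarrow> f = g)"

definition prod_cat :: "'i set \<Rightarrow> ('i \<Rightarrow> ('o, 'm) cat) \<Rightarrow> ('i \<Rightarrow> 'o, 'i \<Rightarrow> 'm) cat" where
  "prod_cat I A =
     \<lparr>Obj = (\<Pi>\<^sub>E i\<in>I. Obj (A i)),
      Mor = (\<Pi>\<^sub>E i\<in>I. Mor (A i)),
      source = (\<lambda>f. \<lambda>i\<in>I. source (A i) (f i)),
      target = (\<lambda>f. \<lambda>i\<in>I. target (A i) (f i)),
      ident = (\<lambda>X. \<lambda>i\<in>I. ident (A i) (X i)),
      cmp = (\<lambda>g f. \<lambda>i\<in>I. cmp (A i) (g i) (f i))\<rparr>"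

definition prod_functor ::
  "'i set \<Rightarrow> ('i \<Rightarrow> ('o1, 'm1) cat) \<Rightarrow> ('i \<Rightarrow> ('o1, 'm1, 'o2, 'm2) ftor)
    \<Rightarrow> ('i \<Rightarrow> 'o1, 'i \<Rightarrow> 'm1, 'i \<Rightarrow> 'o2, 'i \<Rightarrow> 'm2) ftor" where
  "prod_functor I A F =
     \<lparr>FObj = (\<lambda>X\<in>Obj (prod_cat I A). \<lambda>i\<in>I. FObj (F i) (X i)),
      FMor = (\<lambda>f\<in>Mor (prod_cat I A). \<lambda>i\<in>I. FMor (F i) (f i))\<rparr>"

section \<open>Words and elementary rewritings\<close>

text \<open>\<open>Fwd f\<close> is the morphism \<open>f\<close> as a mere arrow, \<open>Bwd s\<close> is the formal arrow going in the
  direction opposite to \<open>s\<close>.\<close>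

datatype 'm arrow = Fwd 'm | Bwd 'm

definition arrows :: "('o, 'm) cat \<Rightarrow> 'm set \<Rightarrow> 'm arrow set" where
  "arrows C S = Fwd ` Mor C \<union> Bwd ` S"

fun asource :: "('o, 'm) cat \<Rightarrow> 'm arrow \<Rightarrow> 'o" where
  "asource C (Fwd f) = source C f"
| "asource C (Bwd s) = target C s"

fun atarget :: "('o, 'm) cat \<Rightarrow> 'm arrow \<Rightarrow> 'o" where
  "atarget C (Fwd f) = target C f"
| "atarget C (Bwd s) = source C s"

text \<open>The formal composition \<open>a\<^sub>m * \<dots> * a\<^sub>1\<close> is the list \<open>[a\<^sub>m, \<dots>, a\<^sub>1]\<close>, in the same order: the arrow
  applied first is the last list element, and formal composition is \<open>@\<close>.\<close>

definition words :: "('o, 'm) cat \<Rightarrow> 'm set \<Rightarrow> 'm arrow list set" where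
  "words C S = {P. P \<noteq> [] \<and> set P \<subseteq> arrows C S \<and>
     successively (\<lambda>b a. asource C b = atarget C a) P}"

definition wsource :: "('o, 'm) cat \<Rightarrow> 'm arrow list \<Rightarrow> 'o" where
  "wsource C P = asource C (last P)"

definition wtarget :: "('o, 'm) cat \<Rightarrow> 'm arrow list \<Rightarrow> 'o" where
  "wtarget C P = atarget C (hd P)"

inductive elem_rule :: "('o, 'm) cat \<Rightarrow> 'm set \<Rightarrow> 'm arrow list \<Rightarrow> 'm arrow list \<Rightarrow> bool"
  for C :: "('o, 'm) cat" and S :: "'m set" where
  rule_cmp: "\<lbrakk>f \<in> Mor C; g \<in> Mor C; source C g = target C f\<rbrakk>
    \<Longrightarrow> elem_rule C S [Fwd g, Fwd f] [Fwd (cmp C g f)]"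
| rule_ident_left: "a \<in> arrows C S \<Longrightarrow> elem_rule C S [Fwd (ident C (atarget C a)), a] [a]"
| rule_ident_right: "a \<in> arrows C S \<Longrightarrow> elem_rule C S [a, Fwd (ident C (asource C a))] [a]"
| rule_inv_right: "s \<in> S \<Longrightarrow> elem_rule C S [Fwd s, Bwd s] [Fwd (ident C (target C s))]"
| rule_inv_left: "s \<in> S \<Longrightarrow> elem_rule C S [Bwd s, Fwd s] [Fwd (ident C (source C s))]"

definition rewrite_step :: "('o, 'm) cat \<Rightarrow> 'm set \<Rightarrow> 'm arrow list \<Rightarrow> 'm arrow list \<Rightarrow> bool" where
  "rewrite_step C S P Q \<longleftrightarrow> P \<in> words C S \<and> Q \<in> words C S \<and>
     (\<exists>U V l r. P = U @ l @ V \<and> Q = U @ r @ V \<and> (elem_rule C S l r \<or> elem_rule C S r l))"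

definition word_rel :: "('o, 'm) cat \<Rightarrow> 'm set \<Rightarrow> ('m arrow list \<times> 'm arrow list) set" where
  "word_rel C S = {(P, Q). P \<in> words C S \<and> Q \<in> words C S \<and> (rewrite_step C S)\<^sup>*\<^sup>* P Q}"

definition word_class :: "('o, 'm) cat \<Rightarrow> 'm set \<Rightarrow> 'm arrow list \<Rightarrow> 'm arrow list set" where
  "word_class C S P = word_rel C S `` {P}"

section \<open>Localization\<close>

text \<open>Source, target and composition are computed on chosen representatives; rewriting preserves the
  source and target of a word and is compatible with \<open>@\<close>, so the choices do not matter.\<close>

definition localization :: "('o, 'm) cat \<Rightarrow> 'm set \<Rightarrow> ('o, 'm arrow list set) cat" where
  "localization C S =
     \<lparr>Obj = Obj C,
      Mor = words C S // word_rel C S,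
      source = (\<lambda>c. wsource C (SOME P. P \<in> c)),
      target = (\<lambda>c. wtarget C (SOME P. P \<in> c)),
      ident = (\<lambda>X. word_class C S [Fwd (ident C X)]),
      cmp = (\<lambda>d c. word_class C S ((SOME Q. Q \<in> d) @ (SOME P. P \<in> c)))\<rparr>"

definition loc_functor ::
  "('o, 'm) cat \<Rightarrow> 'm set \<Rightarrow> ('o, 'm, 'o, 'm arrow list set) ftor" where
  "loc_functor C S =
     \<lparr>FObj = (\<lambda>X\<in>Obj C. X), FMor = (\<lambda>f\<in>Mor C. word_class C S [Fwd f])\<rparr>"

text \<open>The description is proper: by the universal property of the localization there is exactly one
  such functor as soon as every \<open>A i\<close> is a category and \<open>S i \<subseteq> Mor (A i)\<close>.\<close>

definition theta ::
  "'i set \<Rightarrow> ('i \<Rightarrow> ('o, 'm) cat) \<Rightarrow> ('i \<Rightarrow> 'm set)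
    \<Rightarrow> ('i \<Rightarrow> 'o, ('i \<Rightarrow> 'm) arrow list set, 'i \<Rightarrow> 'o, 'i \<Rightarrow> 'm arrow list set) ftor" where
  "theta I A S =
     (THE T. is_functor (localization (prod_cat I A) (\<Pi>\<^sub>E i\<in>I. S i))
               (prod_cat I (\<lambda>i. localization (A i) (S i))) T \<and>
        functor_comp (prod_cat I A) T (loc_functor (prod_cat I A) (\<Pi>\<^sub>E i\<in>I. S i)) =
          prod_functor I A (\<lambda>i. loc_functor (A i) (S i)))"

section \<open>Rewriting distance\<close>

text \<open>Meaningful for equivalent words only, as these are the ones for which the set of numbers of
  steps is nonempty.\<close>

definition rewrite_dist :: "('o, 'm) cat \<Rightarrow> 'm set \<Rightarrow> 'm arrow list \<Rightarrow> 'm arrow list \<Rightarrow> nat" where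
  "rewrite_dist C S P Q = (LEAST n. (rewrite_step C S ^^ n) P Q)"

text \<open>The supremum is taken in \<open>enat\<close>, where the supremum of the empty set is \<open>0\<close>.\<close>

definition rewrite_bound :: "('o, 'm) cat \<Rightarrow> 'm set \<Rightarrow> nat \<Rightarrow> enat" where
  "rewrite_bound C S L = Sup {enat (rewrite_dist C S P Q) | P Q.
     P \<in> words C S \<and> Q \<in> words C S \<and> word_class C S P = word_class C S Q \<and>
     length P \<le> L \<and> length Q \<le> L}"

end

theory Submission
  imports Defs
begin

text \<open>
  The functor \<open>\<Theta>\<close> is computed coordinatewise: a word over the product category has a coordinate word
  for each index, and \<open>\<Theta>\<close> sends the class of the word to the family of the classes of its
  coordinates. So \<open>\<Theta>\<close> is faithful exactly when two words over the product are equivalent as soon as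
  all their coordinates are (\<open>faithful_theta_iff\<close>; the uniqueness in the universal property
  identifies \<open>\<Theta>\<close> with the coordinatewise functor). The question is when infinitely many
  rewritings, one for each coordinate, can be carried out by finitely many rewritings of the whole
  product.

  If they can, with \<open>n\<close> steps, then projecting these steps shows that every coordinate needs at most
  \<open>n\<close> steps. This makes the condition necessary. A word over the product has the same pattern of
  forward and backward arrows in all coordinates, and coordinate words with a common pattern assemble
  to a word over the product (\<open>product_word\<close>). If \<open>d\<^sub>i(L)\<close> were not uniformly bounded off a finite set,
  then, as there are only finitely many patterns of length at most \<open>L\<close>, one pair of patterns would be
  responsible. Distinct indices could be chosen at which equivalent words with these patterns are at
  larger and larger distance. Assembled to two words over the product, with words of identities in all
  other coordinates, where an object exists because the categories are nonempty, they would be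
  coordinatewise equivalent without being equivalent (\<open>bound_for_shapes\<close>).

  For the other direction, let all coordinates of two words be at distance at most \<open>D\<close>, and
  use induction on \<open>D\<close> (\<open>rel_if_bounded\<close>). The first step of each coordinate happens at
  one of finitely many positions, in one of two directions, and leads to one of finitely many patterns.
  This partitions the index set into finitely many blocks. On a single block the words reached by the
  first steps have a common pattern, so they form a word over the product of the block, and the
  first steps form a single rewriting step there, because the patterns before and after a step
  determine which rule was used, if unit rules for forward arrows are read as composition. What
  remains is to glue finitely many blocks together, that is, to show that words over a product of two
  factors are equivalent when both of their parts are (\<open>rel_glue_two\<close>). This is where identities being
  in \<open>S\<^sub>i\<close> matters: a word is equivalent to its part outside one factor, padded with identities there,
  followed by its part in that factor, padded likewise, because the two kinds of padded arrows, forward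
  or backward, commute past one another (\<open>rel_split_word\<close>).
\<close>

section \<open>Calculating with words up to rewriting\<close>

lemma words_nonempty: "P \<in> words C S \<Longrightarrow> P \<noteq> []"
  by (simp add: words_def)

lemma words_arrows: "P \<in> words C S \<Longrightarrow> set P \<subseteq> arrows C S"
  by (simp add: words_def)

lemma words_single [simp]: "[a] \<in> words C S \<longleftrightarrow> a \<in> arrows C S"
  by (simp add: words_def)

lemma words_append:
  "P \<noteq> [] \<Longrightarrow> Q \<noteq> [] \<Longrightarrow> P @ Q \<in> words C S \<longleftrightarrow>
    P \<in> words C S \<and> Q \<in> words C S \<and> wsource C P = wtarget C Q"
  by (auto simp: words_def wsource_def wtarget_def successively_append_iff)

lemma words_Cons:
  "Q \<noteq> [] \<Longrightarrow> a # Q \<in> words C S \<longleftrightarrow>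
    a \<in> arrows C S \<and> Q \<in> words C S \<and> asource C a = wtarget C Q"
  using words_append[of "[a]" Q C S] by (simp add: wsource_def)

lemma wsource_append [simp]: "Q \<noteq> [] \<Longrightarrow> wsource C (P @ Q) = wsource C Q"
  by (simp add: wsource_def)

lemma wtarget_append [simp]: "P \<noteq> [] \<Longrightarrow> wtarget C (P @ Q) = wtarget C P"
  by (simp add: wtarget_def)

lemma wsource_single [simp]: "wsource C [a] = asource C a"
  by (simp add: wsource_def)

lemma wtarget_Cons [simp]: "wtarget C (a # P) = atarget C a"
  by (simp add: wtarget_def)

lemma wsource_Cons [simp]: "P \<noteq> [] \<Longrightarrow> wsource C (a # P) = wsource C P"
  by (simp add: wsource_def)

lemma Fwd_arrows [simp]: "Fwd f \<in> arrows C S \<longleftrightarrow> f \<in> Mor C"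
  by (auto simp: arrows_def)

lemma Bwd_arrows [simp]: "Bwd s \<in> arrows C S \<longleftrightarrow> s \<in> S"
  by (auto simp: arrows_def)

lemma elem_rule_length: "elem_rule C S l r \<Longrightarrow> length l = 2 \<and> length r = 1"
  by (induction rule: elem_rule.induct) auto

lemma rewrite_step_sym: "rewrite_step C S P Q \<Longrightarrow> rewrite_step C S Q P"
  unfolding rewrite_step_def by blast

lemma rewrite_steps_words:
  "(rewrite_step C S)\<^sup>*\<^sup>* P Q \<Longrightarrow> P \<in> words C S \<Longrightarrow> Q \<in> words C S"
  by (induction rule: rtranclp_induct) (auto simp: rewrite_step_def)

text \<open>A binary predicate in place of membership in \<open>word_rel\<close>, so that equivalences can be chained in
  calculations.\<close>

definition word_equiv :: "('o, 'm) cat \<Rightarrow> 'm set \<Rightarrow> 'm arrow list \<Rightarrow> 'm arrow list \<Rightarrow> bool" where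
  "word_equiv C S P Q \<longleftrightarrow> (P, Q) \<in> word_rel C S"

lemma word_equiv_iff:
  "word_equiv C S P Q \<longleftrightarrow> P \<in> words C S \<and> (rewrite_step C S)\<^sup>*\<^sup>* P Q"
  by (auto simp: word_equiv_def word_rel_def dest: rewrite_steps_words)

lemma word_equiv_words:
  assumes "word_equiv C S P Q"
  shows "P \<in> words C S" "Q \<in> words C S"
  using assms by (auto simp: word_equiv_def word_rel_def)

lemma equiv_word_rel: "equiv (words C S) (word_rel C S)"
proof (rule equivI)
  show "word_rel C S \<subseteq> words C S \<times> words C S"
    by (auto simp: word_rel_def)
  show "refl_on (words C S) (word_rel C S)"
    by (auto simp: refl_on_def word_rel_def)
  have "symp (rewrite_step C S)"
    by (auto simp: symp_def rewrite_step_sym)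
  then have "symp (rewrite_step C S)\<^sup>*\<^sup>*"
    by (rule symp_rtranclp)
  then show "sym (word_rel C S)"
    by (auto simp: sym_def symp_def word_rel_def)
  show "trans (word_rel C S)"
    by (auto simp: trans_def word_rel_def)
qed

lemma word_class_eq_iff:
  "P \<in> words C S \<Longrightarrow> Q \<in> words C S \<Longrightarrow>
    word_class C S P = word_class C S Q \<longleftrightarrow> word_equiv C S P Q"
  unfolding word_class_def word_equiv_def using eq_equiv_class_iff[OF equiv_word_rel] by metis

lemma word_class_eqI: "word_equiv C S P Q \<Longrightarrow> word_class C S P = word_class C S Q"
  using word_class_eq_iff word_equiv_words by metis

locale marked_category = category C for C :: "('o, 'm) cat" +
  fixes S :: "'m set"
  assumes marked_subset: "S \<subseteq> Mor C"
begin

abbreviation rel :: "'m arrow list \<Rightarrow> 'm arrow list \<Rightarrow> bool" (infix "\<approx>" 50) where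
  "P \<approx> Q \<equiv> word_equiv C S P Q"

lemma marked_in [simp]: "s \<in> S \<Longrightarrow> s \<in> Mor C"
  using marked_subset by blast

lemmas cat_simps [simp] = source_in target_in ident_in source_ident target_ident cmp_in
  source_cmp target_cmp ident_cmp cmp_ident

lemma asource_in [simp]: "a \<in> arrows C S \<Longrightarrow> asource C a \<in> Obj C"
  by (cases a) auto

lemma atarget_in [simp]: "a \<in> arrows C S \<Longrightarrow> atarget C a \<in> Obj C"
  by (cases a) auto

lemma wsource_in [simp]: "P \<in> words C S \<Longrightarrow> wsource C P \<in> Obj C"
  unfolding wsource_def using words_arrows words_nonempty by (metis asource_in last_in_set subsetD)

lemma wtarget_in [simp]: "P \<in> words C S \<Longrightarrow> wtarget C P \<in> Obj C"
  unfolding wtarget_def using words_arrows words_nonempty by (metis atarget_in hd_in_set subsetD)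

lemma elem_rule_ends:
  "elem_rule C S l r \<Longrightarrow> l \<in> words C S \<and> r \<in> words C S \<and>
    wsource C l = wsource C r \<and> wtarget C l = wtarget C r"
  by (induction rule: elem_rule.induct) (auto simp: words_Cons)

text \<open>Well-formedness of a word depends on a subword only through its endpoints, which both sides of a
  rewriting rule share.\<close>

lemma rewrite_context:
  assumes "l \<in> words C S" "r \<in> words C S" "wsource C l = wsource C r" "wtarget C l = wtarget C r"
    and "U @ l @ V \<in> words C S"
  shows "U @ r @ V \<in> words C S \<and> wsource C (U @ l @ V) = wsource C (U @ r @ V) \<and>
    wtarget C (U @ l @ V) = wtarget C (U @ r @ V)"
proof -
  have ne: "l \<noteq> []" "r \<noteq> []"
    using assms words_nonempty by auto
  then show ?thesis
    using assms by (cases "U = []"; cases "V = []") (auto simp: words_append)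
qed

lemma rewrite_step_ends:
  assumes "rewrite_step C S P Q"
  shows "wsource C P = wsource C Q" "wtarget C P = wtarget C Q"
proof -
  obtain U V l r where PQ: "P = U @ l @ V" "Q = U @ r @ V" and "elem_rule C S l r \<or> elem_rule C S r l"
      and P: "P \<in> words C S"
    using assms by (auto simp: rewrite_step_def)
  then have "l \<in> words C S \<and> r \<in> words C S \<and> wsource C l = wsource C r \<and> wtarget C l = wtarget C r"
    using elem_rule_ends by metis
  then show "wsource C P = wsource C Q" "wtarget C P = wtarget C Q"
    using rewrite_context[of l r U V] PQ P by auto
qed

lemma rel_ends:
  assumes "P \<approx> Q"
  shows "wsource C P = wsource C Q" "wtarget C P = wtarget C Q"
proof -
  have "(rewrite_step C S)\<^sup>*\<^sup>* P Q"
    using assms by (simp add: word_equiv_iff)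
  then have "wsource C P = wsource C Q \<and> wtarget C P = wtarget C Q"
    by (induction rule: rtranclp_induct) (auto dest: rewrite_step_ends)
  then show "wsource C P = wsource C Q" "wtarget C P = wtarget C Q"
    by auto
qed

lemma rel_refl: "P \<in> words C S \<Longrightarrow> P \<approx> P"
  by (simp add: word_equiv_iff)

lemma rel_sym: "P \<approx> Q \<Longrightarrow> Q \<approx> P"
  unfolding word_equiv_def using equiv_word_rel by (meson equivE symD)

lemma rel_trans [trans]: "P \<approx> Q \<Longrightarrow> Q \<approx> R \<Longrightarrow> P \<approx> R"
  unfolding word_equiv_def using equiv_word_rel by (meson equivE transD)

lemma step_rel: "rewrite_step C S P Q \<Longrightarrow> P \<approx> Q"
  by (simp add: word_equiv_iff r_into_rtranclp) (simp add: rewrite_step_def)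

lemma elem_rel:
  assumes "elem_rule C S l r"
  shows "l \<approx> r"
proof (rule step_rel)
  have "l = [] @ l @ []" "r = [] @ r @ []"
    by simp_all
  then show "rewrite_step C S l r"
    unfolding rewrite_step_def using assms elem_rule_ends[OF assms] by blast
qed

lemma rewrite_step_context:
  assumes "rewrite_step C S P Q" and "U @ P @ V \<in> words C S"
  shows "rewrite_step C S (U @ P @ V) (U @ Q @ V)"
proof -
  obtain U' V' l r where PQ: "P = U' @ l @ V'" "Q = U' @ r @ V'"
      and lr: "elem_rule C S l r \<or> elem_rule C S r l" and "P \<in> words C S" "Q \<in> words C S"
    using assms(1) by (auto simp: rewrite_step_def)
  then have "U @ Q @ V \<in> words C S"
    using rewrite_context[of P Q U V] rewrite_step_ends[OF assms(1)] assms(2) by blast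
  moreover have "U @ P @ V = (U @ U') @ l @ (V' @ V)" "U @ Q @ V = (U @ U') @ r @ (V' @ V)"
    using PQ by simp_all
  ultimately show ?thesis
    unfolding rewrite_step_def using lr assms(2) by blast
qed

lemma rel_context:
  assumes "P \<approx> Q" and "U @ P @ V \<in> words C S"
  shows "U @ P @ V \<approx> U @ Q @ V"
proof -
  have "(rewrite_step C S)\<^sup>*\<^sup>* P Q"
    using assms by (simp add: word_equiv_iff)
  then show ?thesis
  proof (induction rule: rtranclp_induct)
    case base
    show ?case
      using assms(2) by (rule rel_refl)
  next
    case (step Q R)
    then have "U @ Q @ V \<in> words C S"
      by (auto dest: word_equiv_words)
    then show ?case
      using step rewrite_step_context step_rel rel_trans by meson
  qed
qed

lemma rel_append:
  assumes "P \<approx> P'" "Q \<approx> Q'" "wsource C P = wtarget C Q"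
  shows "P @ Q \<approx> P' @ Q'"
proof -
  have ne: "P \<noteq> []" "Q \<noteq> []" "P' \<noteq> []" "Q' \<noteq> []"
    using assms word_equiv_words words_nonempty by blast+
  have w: "P @ Q \<in> words C S" "P' @ Q \<in> words C S"
    using assms ne by (auto simp: words_append dest: word_equiv_words rel_ends)
  have "P @ Q \<approx> P' @ Q"
    using rel_context[OF assms(1), of "[]" Q] w by simp
  also have "P' @ Q \<approx> P' @ Q'"
    using rel_context[OF assms(2), of P' "[]"] w by simp
  finally show ?thesis .
qed

lemma rel_ident_left:
  assumes "P \<in> words C S"
  shows "[Fwd (ident C (wtarget C P))] @ P \<approx> P"
proof -
  obtain a V where P: "P = a # V"
    using assms words_nonempty by (cases P) auto
  then have a: "a \<in> arrows C S"
    using words_arrows[OF assms] by simp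
  have "[] @ [Fwd (ident C (atarget C a)), a] @ V \<approx> [] @ [a] @ V"
    by (rule rel_context[OF elem_rel[OF rule_ident_left[OF a]]])
      (use P assms a in \<open>auto simp: words_Cons\<close>)
  then show ?thesis
    using P by simp
qed

lemma rel_ident_right:
  assumes "P \<in> words C S"
  shows "P @ [Fwd (ident C (wsource C P))] \<approx> P"
proof -
  obtain a V where P: "P = V @ [a]"
    using assms words_nonempty by (metis append_butlast_last_id)
  then have a: "a \<in> arrows C S"
    using words_arrows[OF assms] by simp
  have "V @ [a, Fwd (ident C (asource C a))] @ [] \<approx> V @ [a] @ []"
    by (rule rel_context[OF elem_rel[OF rule_ident_right[OF a]]])
      (use P assms a in \<open>cases "V = []"; auto simp: words_append words_Cons\<close>)
  then show ?thesis
    using P by simp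
qed

lemma rel_cancel_left:
  assumes "s \<in> S" "P \<in> words C S" "wtarget C P = source C s"
  shows "[Bwd s] @ [Fwd s] @ P \<approx> P"
proof -
  have "[Bwd s, Fwd s] @ P \<approx> [Fwd (ident C (wtarget C P))] @ P"
    using rel_append[OF elem_rel[OF rule_inv_left[OF assms(1)]] rel_refl[OF assms(2)]] assms by simp
  also have "\<dots> \<approx> P"
    by (rule rel_ident_left[OF assms(2)])
  finally show ?thesis
    by simp
qed

lemma rel_cancel_right:
  assumes "s \<in> S" "P \<in> words C S" "wsource C P = target C s"
  shows "P @ [Fwd s] @ [Bwd s] \<approx> P"
proof -
  have "P @ [Fwd s, Bwd s] \<approx> P @ [Fwd (ident C (wsource C P))]"
    using rel_append[OF rel_refl[OF assms(2)] elem_rel[OF rule_inv_right[OF assms(1)]]] assms by simp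
  also have "\<dots> \<approx> P"
    by (rule rel_ident_right[OF assms(2)])
  finally show ?thesis
    by simp
qed

text \<open>The device for passing from forward to backward arrows: a commutative square with two opposite
  sides in \<open>S\<close> remains commutative after these two sides are inverted.\<close>

lemma rel_invert_square:
  assumes s: "s \<in> S" "t \<in> S" and h: "h \<in> words C S" and g: "g \<in> words C S"
    and sq: "[Fwd t] @ h \<approx> g @ [Fwd s]"
  shows "h @ [Bwd s] \<approx> [Bwd t] @ g"
proof -
  have ne: "h \<noteq> []" "g \<noteq> []"
    using h g words_nonempty by auto
  have w: "[Fwd t] @ h \<in> words C S" "g @ [Fwd s] \<in> words C S"
    using word_equiv_words[OF sq] by auto
  have ends: "wtarget C h = source C t" "wsource C g = target C s"
      "wsource C h = source C s" "wtarget C g = target C t"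
    using w rel_ends[OF sq] ne by (auto simp: words_Cons words_append)
  have "h @ [Bwd s] \<approx> ([Bwd t] @ [Fwd t] @ h) @ [Bwd s]"
    by (rule rel_append[OF rel_sym[OF rel_cancel_left]]) (use ends s h in \<open>auto intro!: rel_refl\<close>)
  also have "\<dots> = [Bwd t] @ ([Fwd t] @ h) @ [Bwd s]"
    by simp
  also have "\<dots> \<approx> [Bwd t] @ (g @ [Fwd s]) @ [Bwd s]"
    by (rule rel_context[OF sq]) (use ends s h ne in \<open>auto simp: words_Cons words_append\<close>)
  also have "\<dots> = ([Bwd t] @ g) @ [Fwd s] @ [Bwd s]"
    by simp
  also have "\<dots> \<approx> [Bwd t] @ g"
    by (rule rel_cancel_right) (use ends s g ne in \<open>auto simp: words_Cons\<close>)
  finally show ?thesis .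
qed

text \<open>The square with sides \<open>s\<close> and \<open>t \<circ> s\<close> whose other sides are an identity and the inverse of \<open>t\<close> is
  inverted.\<close>

lemma rel_Bwd_cmp:
  assumes "s \<in> S" "t \<in> S" "cmp C t s \<in> S" "source C t = target C s"
  shows "[Bwd (cmp C t s)] \<approx> [Bwd s, Bwd t]"
proof -
  let ?i = "[Fwd (ident C (source C s))]"
  have "[Bwd t] @ [Fwd (cmp C t s)] \<approx> [Bwd t] @ [Fwd t, Fwd s]"
    by (rule rel_append[OF rel_refl rel_sym[OF elem_rel[OF rule_cmp]]]) (use assms in auto)
  also have "\<dots> \<approx> [Fwd s]"
    using rel_cancel_left[of t "[Fwd s]"] assms by simp
  also have "\<dots> \<approx> [Fwd s] @ ?i"
    using rel_sym[OF rel_ident_right[of "[Fwd s]"]] assms by simp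
  finally have sq: "[Fwd s] @ ?i \<approx> [Bwd t] @ [Fwd (cmp C t s)]"
    by (rule rel_sym)
  have "[Bwd (cmp C t s)] \<approx> ?i @ [Bwd (cmp C t s)]"
    using rel_sym[OF rel_ident_left[of "[Bwd (cmp C t s)]"]] assms by simp
  also have "\<dots> \<approx> [Bwd s] @ [Bwd t]"
    by (rule rel_invert_square[OF _ _ _ _ sq]) (use assms in auto)
  finally show ?thesis
    by simp
qed

lemma rel_Bwd_ident:
  assumes "X \<in> Obj C" "ident C X \<in> S"
  shows "[Bwd (ident C X)] \<approx> [Fwd (ident C X)]"
proof -
  let ?i = "ident C X"
  have "[Bwd ?i] \<approx> [Bwd ?i] @ [Fwd ?i]"
    using rel_sym[OF rel_ident_right[of "[Bwd ?i]"]] assms by simp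
  also have "\<dots> \<approx> [Fwd ?i]"
    using elem_rel[OF rule_inv_left[OF assms(2)]] assms by simp
  finally show ?thesis .
qed

text \<open>Words of identities take arbitrary patterns of forward and backward arrows, which makes
  them fill coordinates in which nothing happens.\<close>

lemma rel_identity_word:
  assumes "X \<in> Obj C" "ident C X \<in> S" "P \<noteq> []" "set P \<subseteq> {Fwd (ident C X), Bwd (ident C X)}"
  shows "P \<approx> [Fwd (ident C X)]"
  using assms(3,4)
proof (induction P rule: list_nonempty_induct)
  case (single a)
  then show ?case
    using assms by (auto intro: rel_refl rel_Bwd_ident)
next
  case (cons a P)
  have a: "[a] \<approx> [Fwd (ident C X)]"
    using cons assms by (auto intro: rel_refl rel_Bwd_ident)
  have P: "P \<approx> [Fwd (ident C X)]"
    using cons by simp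
  have "[a] @ P \<approx> [Fwd (ident C X)] @ [Fwd (ident C X)]"
    by (rule rel_append[OF a P]) (use rel_ends[OF a] rel_ends[OF P] assms in auto)
  also have "\<dots> \<approx> [Fwd (ident C X)]"
    using rel_ident_left[of "[Fwd (ident C X)]"] assms by simp
  finally show ?case
    by simp
qed

end

section \<open>The localization as a category\<close>

context marked_category
begin

lemma some_representative:
  assumes "P \<in> words C S"
  shows "P \<approx> (SOME Q. Q \<in> word_class C S P)"
proof -
  have "P \<in> word_class C S P"
    using rel_refl[OF assms] by (simp add: word_class_def word_equiv_def)
  then have "(SOME Q. Q \<in> word_class C S P) \<in> word_class C S P"
    by (rule someI)
  then show ?thesis
    by (simp add: word_class_def word_equiv_def)
qed

lemma Obj_localization [simp]: "Obj (localization C S) = Obj C"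
  by (simp add: localization_def)

lemma word_class_in_localization [simp]:
  "P \<in> words C S \<Longrightarrow> word_class C S P \<in> Mor (localization C S)"
  by (simp add: localization_def word_class_def quotientI)

lemma localization_morE:
  assumes "c \<in> Mor (localization C S)"
  obtains P where "P \<in> words C S" "c = word_class C S P"
  using assms by (auto simp: localization_def word_class_def elim: quotientE)

lemma source_localization [simp]:
  "P \<in> words C S \<Longrightarrow> source (localization C S) (word_class C S P) = wsource C P"
  using rel_ends[OF some_representative] by (simp add: localization_def)

lemma target_localization [simp]:
  "P \<in> words C S \<Longrightarrow> target (localization C S) (word_class C S P) = wtarget C P"
  using rel_ends[OF some_representative] by (simp add: localization_def)

lemma ident_localization [simp]:
  "ident (localization C S) X = word_class C S [Fwd (ident C X)]"
  by (simp add: localization_def)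

lemma cmp_localization [simp]:
  assumes "P \<in> words C S" "Q \<in> words C S" "wsource C Q = wtarget C P"
  shows "cmp (localization C S) (word_class C S Q) (word_class C S P) = word_class C S (Q @ P)"
  unfolding localization_def
  using word_class_eqI[OF rel_append[OF some_representative some_representative]] assms by simp

lemma category_localization: "category (localization C S)"
proof
  fix f assume "f \<in> Mor (localization C S)"
  then obtain P where P: "P \<in> words C S" "f = word_class C S P"
    by (rule localization_morE)
  then have ne: "P \<noteq> []"
    by (simp add: words_nonempty)
  show "source (localization C S) f \<in> Obj (localization C S)"
    "target (localization C S) f \<in> Obj (localization C S)"
    using P by simp_all
  show "cmp (localization C S) (ident (localization C S) (target (localization C S) f)) f = f"
    using P word_class_eqI[OF rel_ident_left] by simp
  show "cmp (localization C S) f (ident (localization C S) (source (localization C S) f)) = f"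
    using P word_class_eqI[OF rel_ident_right] by simp
  fix g assume "g \<in> Mor (localization C S)"
    and gf: "source (localization C S) g = target (localization C S) f"
  then obtain Q where Q: "Q \<in> words C S" "g = word_class C S Q"
    by (auto elim: localization_morE)
  have c: "wsource C Q = wtarget C P"
    using P Q gf by simp
  have ne': "Q \<noteq> []"
    using Q by (simp add: words_nonempty)
  show "cmp (localization C S) g f \<in> Mor (localization C S)"
    "source (localization C S) (cmp (localization C S) g f) = source (localization C S) f"
    "target (localization C S) (cmp (localization C S) g f) = target (localization C S) g"
    using P Q c ne ne' by (simp_all add: words_append)
  fix h assume "h \<in> Mor (localization C S)"
    and hg: "source (localization C S) h = target (localization C S) g"
  then obtain R where R: "R \<in> words C S" "h = word_class C S R"
    by (auto elim: localization_morE)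
  have ne'': "R \<noteq> []"
    using R by (simp add: words_nonempty)
  show "cmp (localization C S) h (cmp (localization C S) g f) =
      cmp (localization C S) (cmp (localization C S) h g) f"
    using P Q R c hg ne ne' ne'' by (simp add: words_append)
next
  fix X assume "X \<in> Obj (localization C S)"
  then show "ident (localization C S) X \<in> Mor (localization C S)"
    "source (localization C S) (ident (localization C S) X) = X"
    "target (localization C S) (ident (localization C S) X) = X"
    by simp_all
qed

end

section \<open>Functors preserving the marked morphisms\<close>

abbreviation map_word :: "('m \<Rightarrow> 'n) \<Rightarrow> 'm arrow list \<Rightarrow> 'n arrow list" where
  "map_word h \<equiv> map (map_arrow h)"

text \<open>The functor is given by maps on objects and morphisms that need not be extensional, so that
  projections and restrictions can be taken literally.\<close>

locale marked_functor = dom: marked_category C S + cod: marked_category D T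
  for C :: "('o, 'm) cat" and S and D :: "('p, 'n) cat" and T +
  fixes ho :: "'o \<Rightarrow> 'p" and h :: "'m \<Rightarrow> 'n"
  assumes h_in [simp]: "f \<in> Mor C \<Longrightarrow> h f \<in> Mor D"
    and h_marked [simp]: "s \<in> S \<Longrightarrow> h s \<in> T"
    and h_source [simp]: "f \<in> Mor C \<Longrightarrow> source D (h f) = ho (source C f)"
    and h_target [simp]: "f \<in> Mor C \<Longrightarrow> target D (h f) = ho (target C f)"
    and h_ident [simp]: "X \<in> Obj C \<Longrightarrow> h (ident C X) = ident D (ho X)"
    and h_cmp [simp]: "\<lbrakk>f \<in> Mor C; g \<in> Mor C; source C g = target C f\<rbrakk>
      \<Longrightarrow> h (cmp C g f) = cmp D (h g) (h f)"
begin

lemma map_arrow_in [simp]: "a \<in> arrows C S \<Longrightarrow> map_arrow h a \<in> arrows D T"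
  by (cases a) auto

lemma asource_map [simp]: "a \<in> arrows C S \<Longrightarrow> asource D (map_arrow h a) = ho (asource C a)"
  by (cases a) auto

lemma atarget_map [simp]: "a \<in> arrows C S \<Longrightarrow> atarget D (map_arrow h a) = ho (atarget C a)"
  by (cases a) auto

lemma wsource_map [simp]: "P \<in> words C S \<Longrightarrow> wsource D (map_word h P) = ho (wsource C P)"
  using words_nonempty[of P C S] subsetD[OF words_arrows[of P C S] last_in_set[of P]]
  by (simp add: wsource_def last_map)

lemma wtarget_map [simp]: "P \<in> words C S \<Longrightarrow> wtarget D (map_word h P) = ho (wtarget C P)"
  using words_nonempty[of P C S] subsetD[OF words_arrows[of P C S] hd_in_set[of P]]
  by (simp add: wtarget_def hd_map)

lemma map_word_in [simp]:
  assumes "P \<in> words C S"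
  shows "map_word h P \<in> words D T"
proof -
  have "P \<noteq> []"
    using assms by (rule words_nonempty)
  then show ?thesis
    using assms by (induction P rule: list_nonempty_induct) (auto simp: words_Cons)
qed

lemma elem_rule_map: "elem_rule C S l r \<Longrightarrow> elem_rule D T (map_word h l) (map_word h r)"
proof (induction rule: elem_rule.induct)
  case (rule_cmp f g)
  then show ?case
    using elem_rule.rule_cmp[of "h f" D "h g" T] by simp
next
  case (rule_ident_left a)
  then show ?case
    using elem_rule.rule_ident_left[of "map_arrow h a" D T] by simp
next
  case (rule_ident_right a)
  then show ?case
    using elem_rule.rule_ident_right[of "map_arrow h a" D T] by simp
next
  case (rule_inv_right s)
  then show ?case
    using elem_rule.rule_inv_right[of "h s" T D] by simp
next
  case (rule_inv_left s)
  then show ?case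
    using elem_rule.rule_inv_left[of "h s" T D] by simp
qed

lemma rewrite_step_map:
  assumes "rewrite_step C S P Q"
  shows "rewrite_step D T (map_word h P) (map_word h Q)"
proof -
  obtain U V l r where PQ: "P = U @ l @ V" "Q = U @ r @ V"
      and lr: "elem_rule C S l r \<or> elem_rule C S r l" and w: "P \<in> words C S" "Q \<in> words C S"
    using assms by (auto simp: rewrite_step_def)
  have "map_word h P = map_word h U @ map_word h l @ map_word h V"
    "map_word h Q = map_word h U @ map_word h r @ map_word h V"
    using PQ by simp_all
  then show ?thesis
    unfolding rewrite_step_def using lr elem_rule_map map_word_in[OF w(1)] map_word_in[OF w(2)]
    by blast
qed

text \<open>The number of steps is preserved, so projecting to a coordinate bounds the distance there.\<close>

lemma rewrite_steps_map:
  "(rewrite_step C S ^^ n) P Q \<Longrightarrow> (rewrite_step D T ^^ n) (map_word h P) (map_word h Q)"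
proof (induction n arbitrary: Q)
  case (Suc n)
  then show ?case
    using rewrite_step_map by (fastforce simp: relcompp_apply)
qed simp

lemma word_equiv_map: "word_equiv C S P Q \<Longrightarrow> word_equiv D T (map_word h P) (map_word h Q)"
  using rewrite_steps_map by (auto simp: word_equiv_iff rtranclp_power)

end

section \<open>Products\<close>

lemma prod_cat_simps:
  "Obj (prod_cat I A) = (\<Pi>\<^sub>E i\<in>I. Obj (A i))"
  "Mor (prod_cat I A) = (\<Pi>\<^sub>E i\<in>I. Mor (A i))"
  "source (prod_cat I A) f = (\<lambda>i\<in>I. source (A i) (f i))"
  "target (prod_cat I A) f = (\<lambda>i\<in>I. target (A i) (f i))"
  "ident (prod_cat I A) X = (\<lambda>i\<in>I. ident (A i) (X i))"
  "cmp (prod_cat I A) g f = (\<lambda>i\<in>I. cmp (A i) (g i) (f i))"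
  by (simp_all add: prod_cat_def)

lemma restrict_eq_iff: "restrict f I = restrict g I \<longleftrightarrow> (\<forall>i\<in>I. f i = g i)"
  by (metis restrict_apply' restrict_ext)

lemma restrict_eq_extensional:
  "x \<in> extensional I \<Longrightarrow> restrict f I = x \<longleftrightarrow> (\<forall>i\<in>I. f i = x i)"
  by (metis extensional_restrict restrict_eq_iff)

lemma category_prod:
  assumes "\<And>i. i \<in> I \<Longrightarrow> category (A i)"
  shows "category (prod_cat I A)"
  by unfold_locales
    (auto simp: prod_cat_simps restrict_eq_iff restrict_eq_extensional PiE_iff assms[THEN category.source_in]
      assms[THEN category.target_in] assms[THEN category.ident_in]
      assms[THEN category.source_ident] assms[THEN category.target_ident]
      assms[THEN category.cmp_in] assms[THEN category.source_cmp] assms[THEN category.target_cmp]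
      assms[THEN category.ident_cmp] assms[THEN category.cmp_ident] assms[THEN category.cmp_assoc])

locale marked_family =
  fixes I :: "'i set" and A :: "'i \<Rightarrow> ('o, 'm) cat" and S :: "'i \<Rightarrow> 'm set"
  assumes marked_cat: "i \<in> I \<Longrightarrow> marked_category (A i) (S i)"
    and ident_marked: "i \<in> I \<Longrightarrow> X \<in> Obj (A i) \<Longrightarrow> ident (A i) X \<in> S i"
begin

abbreviation "M \<equiv> prod_cat I A"
abbreviation "\<Sigma> \<equiv> (\<Pi>\<^sub>E i\<in>I. S i)"

sublocale prod: marked_category M \<Sigma>
proof (intro marked_category.intro marked_category_axioms.intro)
  show "category M"
    by (rule category_prod) (use marked_cat marked_category.axioms in blast)
  show "\<Sigma> \<subseteq> Mor M"
    using marked_category.marked_subset[OF marked_cat] by (auto simp: prod_cat_simps PiE_iff)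
qed

lemma subfamily: "J \<subseteq> I \<Longrightarrow> marked_family J A S"
  using marked_cat ident_marked by (auto simp: marked_family_def)

lemma projection:
  assumes "i \<in> I"
  shows "marked_functor M \<Sigma> (A i) (S i) (\<lambda>X. X i) (\<lambda>f. f i)"
proof -
  interpret marked_category "A i" "S i"
    using assms by (rule marked_cat)
  show ?thesis
    by unfold_locales (use assms in \<open>auto simp: prod_cat_simps\<close>)
qed

text \<open>For \<open>J \<subseteq> I\<close> and a base object \<open>X\<close>, the functor \<open>extend J X\<close> keeps the coordinates in \<open>J\<close> and replaces
  the others by the identities of \<open>X\<close>; \<open>mix J X\<close> is its action on objects.\<close>

definition mix :: "'i set \<Rightarrow> ('i \<Rightarrow> 'o) \<Rightarrow> ('i \<Rightarrow> 'o) \<Rightarrow> 'i \<Rightarrow> 'o" where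
  "mix J X Y = (\<lambda>i\<in>I. if i \<in> J then Y i else X i)"

definition extend :: "'i set \<Rightarrow> ('i \<Rightarrow> 'o) \<Rightarrow> ('i \<Rightarrow> 'm) \<Rightarrow> 'i \<Rightarrow> 'm" where
  "extend J X f = (\<lambda>i\<in>I. if i \<in> J then f i else ident (A i) (X i))"

text \<open>The domain is any \<open>H\<close> between \<open>J\<close> and \<open>I\<close>: the case \<open>H = I\<close> serves to split a word, the case \<open>H = J\<close> to
  transport an equivalence from the factor \<open>J\<close>. Identities have to be marked for \<open>extend J X\<close> to
  preserve marked morphisms.\<close>

lemma extension:
  assumes "J \<subseteq> H" "H \<subseteq> I" "X \<in> Obj M"
  shows "marked_functor (prod_cat H A) (\<Pi>\<^sub>E i\<in>H. S i) M \<Sigma>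
    (mix J X) (extend J X)"
proof -
  interpret H: marked_family H A S
    using assms(2) by (rule subfamily)
  have c: "\<And>i. i \<in> I \<Longrightarrow> category (A i)"
    using marked_cat marked_category.axioms(1) by blast
  have ii: "cmp (A i) (ident (A i) Z) (ident (A i) Z) = ident (A i) Z"
    if "i \<in> I" "Z \<in> Obj (A i)" for i Z
    using c[THEN category.ident_cmp, of i "ident (A i) Z"] c[THEN category.target_ident, of i Z]
      c[THEN category.ident_in, of i Z] that by simp
  show ?thesis
    by unfold_locales
     (use assms in \<open>auto simp: prod_cat_simps extend_def mix_def restrict_eq_iff PiE_iff subsetD ident_marked
       c[THEN category.source_in]
      c[THEN category.target_in] c[THEN category.ident_in]
      c[THEN category.source_ident] c[THEN category.target_ident]
      c[THEN category.cmp_in] ii\<close>)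
qed

lemma restriction:
  assumes "J \<subseteq> I"
  shows "marked_functor M \<Sigma> (prod_cat J A) (\<Pi>\<^sub>E i\<in>J. S i) (\<lambda>X. restrict X J) (\<lambda>f. restrict f J)"
proof -
  interpret J: marked_family J A S
    using assms by (rule subfamily)
  show ?thesis
    by unfold_locales (use assms in \<open>auto simp: prod_cat_simps restrict_eq_iff PiE_iff subsetD\<close>)
qed

end

section \<open>Splitting a product into two factors\<close>

context marked_family
begin

lemma mix_in [simp]: "X \<in> Obj M \<Longrightarrow> Y \<in> Obj M \<Longrightarrow> mix J X Y \<in> Obj M"
  by (auto simp: mix_def prod_cat_simps PiE_iff)

lemma mix_diff [simp]: "mix (I - J) X Y = mix J Y X"
  by (auto simp: mix_def)

lemma mix_same [simp]: "X \<in> Obj M \<Longrightarrow> mix J X X = X"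
  by (auto simp: mix_def prod_cat_simps PiE_iff extensional_restrict)

context
  fixes J X
  assumes JX: "J \<subseteq> I" "X \<in> Obj M"
begin

interpretation E: marked_functor M \<Sigma> M \<Sigma> "mix J X" "extend J X"
  using extension[OF JX(1) order_refl JX(2)] .

lemmas extend_mor [simp] = E.h_in E.h_marked E.h_source E.h_target
lemmas extend_arrow [simp] = E.map_arrow_in E.asource_map E.atarget_map
lemmas extend_word [simp] = E.wsource_map E.wtarget_map E.map_word_in

end

text \<open>Both composites are the morphism with coordinates \<open>g\<close> in \<open>J\<close> and \<open>f\<close> outside.\<close>

lemma rel_swap_mor:
  assumes "J \<subseteq> I" "f \<in> Mor M" "g \<in> Mor M"
  shows "prod.rel ([Fwd (extend (I - J) (target M g) f)] @ [Fwd (extend J (source M f) g)])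
    ([Fwd (extend J (target M f) g)] @ [Fwd (extend (I - J) (source M g) f)])"
proof -
  let ?K = "I - J"
  let ?p = "[Fwd (extend ?K (target M g) f), Fwd (extend J (source M f) g)]"
  let ?q = "[Fwd (extend J (target M f) g), Fwd (extend ?K (source M g) f)]"
  have c: "category (A i)" if "i \<in> I" for i
    using marked_cat[OF that] by (rule marked_category.axioms)
  have eq: "cmp M (extend ?K (target M g) f) (extend J (source M f) g) =
      cmp M (extend J (target M f) g) (extend ?K (source M g) f)"
    using assms
    by (auto simp: extend_def prod_cat_simps PiE_iff restrict_eq_iff subsetD
      c[THEN category.ident_cmp] c[THEN category.cmp_ident])
  have "prod.rel ?p [Fwd (cmp M (extend ?K (target M g) f) (extend J (source M f) g))]"
    by (rule prod.elem_rel[OF rule_cmp]) (use assms in simp_all)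
  moreover have "prod.rel ?q [Fwd (cmp M (extend J (target M f) g) (extend ?K (source M g) f))]"
    by (rule prod.elem_rel[OF rule_cmp]) (use assms in simp_all)
  ultimately show ?thesis
    using eq prod.rel_sym prod.rel_trans by (metis append_Cons append_Nil)
qed

text \<open>A backward arrow commutes with whatever the underlying forward arrow commutes with, by inverting the
  square (\<open>rel_invert_square\<close>).\<close>

lemma rel_swap_arrow:
  assumes "J \<subseteq> I" "a \<in> arrows M \<Sigma>" "b \<in> arrows M \<Sigma>"
  shows "prod.rel
    ([map_arrow (extend (I - J) (atarget M b)) a] @ [map_arrow (extend J (asource M a)) b])
    ([map_arrow (extend J (atarget M a)) b] @ [map_arrow (extend (I - J) (asource M b)) a])"
    (is "?swap a b")
proof -
  have swap_Fwd: "?swap a b" if g: "b = Fwd g" "a \<in> arrows M \<Sigma>" "g \<in> Mor M" for a b g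
  proof (cases a)
    case (Fwd f)
    then show ?thesis
      using rel_swap_mor[of J f g] that assms(1) by simp
  next
    case (Bwd s)
    have "prod.rel
      ([Fwd (extend J (source M s) g)] @ [Bwd (extend (I - J) (source M g) s)])
      ([Bwd (extend (I - J) (target M g) s)] @ [Fwd (extend J (target M s) g)])"
      by (rule prod.rel_invert_square[OF _ _ _ _ rel_swap_mor])
        (use that Bwd assms(1) in simp_all)
    then show ?thesis
      using Bwd g by (auto intro: prod.rel_sym)
  qed
  show ?thesis
  proof (cases b)
    case (Fwd g)
    then show ?thesis
      using assms swap_Fwd[of b g a] Fwd by simp
  next
    case (Bwd t)
    have t: "t \<in> \<Sigma>"
      using Bwd assms(3) by simp
    have sq: "prod.rel
      ([map_arrow (extend (I - J) (target M t)) a] @ [Fwd (extend J (asource M a) t)])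
      ([Fwd (extend J (atarget M a) t)] @ [map_arrow (extend (I - J) (source M t)) a])"
      using swap_Fwd[of "Fwd t" t a] assms t by simp
    have "prod.rel
      ([map_arrow (extend (I - J) (source M t)) a] @ [Bwd (extend J (asource M a) t)])
      ([Bwd (extend J (atarget M a) t)] @ [map_arrow (extend (I - J) (target M t)) a])"
      by (rule prod.rel_invert_square[OF _ _ _ _ prod.rel_sym[OF sq]])
        (use assms t in simp_all)
    then show ?thesis
      using Bwd by simp
  qed
qed

lemma rel_swap_word:
  assumes J: "J \<subseteq> I" and a: "a \<in> arrows M \<Sigma>" and P: "P \<in> words M \<Sigma>"
  shows "prod.rel
    ([map_arrow (extend (I - J) (wtarget M P)) a] @ map_word (extend J (asource M a)) P)
    (map_word (extend J (atarget M a)) P @ [map_arrow (extend (I - J) (wsource M P)) a])"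
proof -
  have "P \<noteq> []"
    using P by (rule words_nonempty)
  then show ?thesis
    using P
  proof (induction P rule: list_nonempty_induct)
    case (single b)
    then show ?case
      using rel_swap_arrow[OF J a, of b] by simp
  next
    case (cons b P)
    let ?K = "I - J"
    have b: "b \<in> arrows M \<Sigma>" and P: "P \<in> words M \<Sigma>" and bP: "asource M b = wtarget M P"
      using cons by (auto simp: words_Cons)
    note ne = \<open>P \<noteq> []\<close>
    let ?EK = "\<lambda>X. [map_arrow (extend ?K X) a]"
    let ?b = "\<lambda>X. [map_arrow (extend J X) b]"
    let ?P = "\<lambda>X. map_word (extend J X) P"
    have "prod.rel ((?EK (atarget M b) @ ?b (asource M a)) @ ?P (asource M a))
      ((?b (atarget M a) @ ?EK (asource M b)) @ ?P (asource M a))"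
      by (rule prod.rel_append[OF rel_swap_arrow[OF J a b] prod.rel_refl])
        (use J a b P bP in simp_all)
    also have "\<dots> = ?b (atarget M a) @ (?EK (wtarget M P) @ ?P (asource M a))"
      using bP by simp
    also have "prod.rel \<dots> (?b (atarget M a) @ (?P (atarget M a) @ ?EK (wsource M P)))"
      by (rule prod.rel_append[OF prod.rel_refl cons.IH[OF P]])
        (use J a b P bP in simp_all)
    finally show ?case
      using ne by simp
  qed
qed

text \<open>A morphism of the product factors through the object that has the coordinates of one end in \<open>J\<close> and
  of the other end outside. A backward arrow needs the factorization in the opposite order,
  since inversion reverses composites.\<close>

lemma rel_split_arrow:
  assumes J: "J \<subseteq> I" and a: "a \<in> arrows M \<Sigma>"
  shows "prod.rel [a] ([map_arrow (extend J (atarget M a)) a] @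
    [map_arrow (extend (I - J) (asource M a)) a])"
proof -
  have c: "category (A i)" if "i \<in> I" for i
    using marked_cat[OF that] by (rule marked_category.axioms)
  show ?thesis
  proof (cases a)
    case (Fwd f)
    let ?g = "extend J (target M f) f" and ?h = "extend (I - J) (source M f) f"
    have f: "f \<in> Mor M"
      using a Fwd by simp
    then have "cmp M ?g ?h = f"
      using J by (auto simp: extend_def prod_cat_simps PiE_iff restrict_eq_extensional
        c[THEN category.ident_cmp] c[THEN category.cmp_ident])
    then have "elem_rule M \<Sigma> [Fwd ?g, Fwd ?h] [Fwd f]"
      using rule_cmp[of ?h M ?g \<Sigma>] J f by simp
    then show ?thesis
      using prod.rel_sym[OF prod.elem_rel] Fwd by simp
  next
    case (Bwd s)
    let ?g = "extend J (source M s) s" and ?h = "extend (I - J) (target M s) s"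
    have s: "s \<in> \<Sigma>" and s': "s \<in> Mor M"
      using a Bwd by simp_all
    then have "cmp M ?h ?g = s"
      using J by (auto simp: extend_def prod_cat_simps PiE_iff restrict_eq_extensional
        c[THEN category.ident_cmp] c[THEN category.cmp_ident])
    then show ?thesis
      using prod.rel_Bwd_cmp[of ?g ?h] Bwd J s s' by simp
  qed
qed

text \<open>Each arrow is split, and then its part outside \<open>J\<close> is moved to the right, past the part in \<open>J\<close> of
  all arrows that are applied before it.\<close>

lemma rel_split_word:
  assumes J: "J \<subseteq> I" and P: "P \<in> words M \<Sigma>"
  shows "prod.rel P (map_word (extend J (wtarget M P)) P @
    map_word (extend (I - J) (wsource M P)) P)"
proof -
  have "P \<noteq> []"
    using P by (rule words_nonempty)
  then show ?thesis
    using P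
  proof (induction P rule: list_nonempty_induct)
    case (single a)
    then show ?case
      using rel_split_arrow[OF J, of a] by simp
  next
    case (cons a P)
    let ?K = "I - J" and ?X = "wsource M P" and ?Y = "atarget M a" and ?Z = "asource M a"
    have a: "a \<in> arrows M \<Sigma>" and P: "P \<in> words M \<Sigma>" and aP: "wtarget M P = ?Z"
      using cons by (auto simp: words_Cons)
    note ne = \<open>P \<noteq> []\<close>
    let ?a = "\<lambda>L X. [map_arrow (extend L X) a]" and ?P = "\<lambda>L X. map_word (extend L X) P"
    have "prod.rel ([a] @ P) ((?a J ?Y @ ?a ?K ?Z) @ (?P J ?Z @ ?P ?K ?X))"
      by (rule prod.rel_append[OF rel_split_arrow[OF J a]]) (use cons.IH[OF P] aP in simp_all)
    also have "\<dots> = ?a J ?Y @ (?a ?K ?Z @ ?P J ?Z) @ ?P ?K ?X"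
      by simp
    also have "prod.rel \<dots> (?a J ?Y @ (?P J ?Y @ ?a ?K ?X) @ ?P ?K ?X)"
      by (rule prod.rel_context)
        (use rel_swap_word[OF J a P] J a P aP ne in \<open>simp_all add: words_append words_Cons\<close>)
    finally show ?case
      using ne by simp
  qed
qed

abbreviation restrict_word :: "'i set \<Rightarrow> ('i \<Rightarrow> 'm) arrow list \<Rightarrow> ('i \<Rightarrow> 'm) arrow list" where
  "restrict_word J \<equiv> map_word (\<lambda>f. restrict f J)"

lemma extend_restrict_word:
  "map_word (extend J X) (restrict_word J P) = map_word (extend J X) P"
proof -
  have "extend J X (restrict f J) = extend J X f" for f
    by (auto simp: extend_def)
  then show ?thesis
    by (simp add: arrow.map_comp comp_def)
qed

text \<open>After splitting, the two parts can be rewritten one after the other, each within its own factor, even if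
  the intermediate words of the two rewritings have different lengths and patterns.\<close>

lemma rel_glue_two:
  assumes J: "J \<subseteq> I" and PQ: "P \<in> words M \<Sigma>" "Q \<in> words M \<Sigma>"
    and eJ: "word_equiv (prod_cat J A) (\<Pi>\<^sub>E i\<in>J. S i) (restrict_word J P) (restrict_word J Q)"
    and eK: "word_equiv (prod_cat (I - J) A) (\<Pi>\<^sub>E i\<in>I - J. S i)
      (restrict_word (I - J) P) (restrict_word (I - J) Q)"
  shows "prod.rel P Q"
proof -
  let ?K = "I - J"
  have K: "?K \<subseteq> I"
    by auto
  interpret J: marked_family J A S
    using J by (rule subfamily)
  interpret K: marked_family ?K A S
    using K by (rule subfamily)
  interpret rJ: marked_functor M \<Sigma> J.M J.\<Sigma> "\<lambda>X. restrict X J" "\<lambda>f. restrict f J"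
    using J by (rule restriction)
  interpret rK: marked_functor M \<Sigma> K.M K.\<Sigma> "\<lambda>X. restrict X ?K" "\<lambda>f. restrict f ?K"
    using K by (rule restriction)
  have ext: "X = Y" if "restrict X J = restrict Y J" "restrict X ?K = restrict Y ?K"
    "X \<in> Obj M" "Y \<in> Obj M" for X Y
  proof (rule PiE_ext)
    show "X \<in> (\<Pi>\<^sub>E i\<in>I. Obj (A i))" "Y \<in> (\<Pi>\<^sub>E i\<in>I. Obj (A i))"
      using that by (simp_all add: prod_cat_simps)
    show "X i = Y i" if "i \<in> I" for i
      using that \<open>restrict X J = _\<close> \<open>restrict X ?K = _\<close> by (metis DiffI restrict_apply')
  qed
  have src: "wsource M P = wsource M Q" and tgt: "wtarget M P = wtarget M Q"
    using J.prod.rel_ends[OF eJ] K.prod.rel_ends[OF eK] PQ by (auto intro!: ext)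
  have part: "prod.rel (map_word (extend L X) P) (map_word (extend L X) Q)"
    if "L \<subseteq> I" "X \<in> Obj M" "word_equiv (prod_cat L A) (\<Pi>\<^sub>E i\<in>L. S i) (restrict_word L P) (restrict_word L Q)"
    for L X
    using marked_functor.word_equiv_map[OF extension[OF order_refl that(1,2)] that(3)]
    by (simp only: extend_restrict_word)
  have "prod.rel P (map_word (extend J (wtarget M P)) P @ map_word (extend ?K (wsource M P)) P)"
    by (rule rel_split_word[OF J PQ(1)])
  also have "prod.rel \<dots> (map_word (extend J (wtarget M P)) Q @ map_word (extend ?K (wsource M P)) Q)"
    by (rule prod.rel_append[OF part part]) (use J K PQ eJ eK in simp_all)
  also have "prod.rel \<dots> Q"
    using prod.rel_sym[OF rel_split_word[OF J PQ(2)]] src tgt by simp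
  finally show ?thesis .
qed

text \<open>The product of the empty family is the terminal category. Its words are not equal when their
  patterns differ, but all of them consist of identities.\<close>

lemma rel_empty_family:
  assumes "I = {}" "P \<in> words M \<Sigma>" "Q \<in> words M \<Sigma>"
  shows "prod.rel P Q"
proof -
  let ?i = "ident M (\<lambda>_. undefined)"
  have o: "(\<lambda>_. undefined) \<in> Obj M" "?i \<in> \<Sigma>"
    using assms(1) by (auto simp: prod_cat_simps)
  have *: "prod.rel W [Fwd ?i]" if "W \<in> words M \<Sigma>" for W
  proof (rule prod.rel_identity_word[OF o])
    show "W \<noteq> []"
      using that by (rule words_nonempty)
    show "set W \<subseteq> {Fwd ?i, Bwd ?i}"
      using words_arrows[OF that] assms(1) by (auto simp: arrows_def prod_cat_simps restrict_def)
  qed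
  show ?thesis
    using *[OF assms(2)] prod.rel_sym[OF *[OF assms(3)]] by (rule prod.rel_trans)
qed

end

lemma restrict_restrict_word:
  "J \<subseteq> H \<Longrightarrow> map_word (\<lambda>f. restrict f J) (map_word (\<lambda>f. restrict f H) P) = map_word (\<lambda>f. restrict f J) P"
  by (simp add: arrow.map_comp comp_def Int_absorb1)

lemma rel_glue_finite:
  assumes "finite T" "marked_family I A S" "ty ` I \<subseteq> T"
    and "P \<in> words (prod_cat I A) (\<Pi>\<^sub>E i\<in>I. S i)" "Q \<in> words (prod_cat I A) (\<Pi>\<^sub>E i\<in>I. S i)"
    and "\<And>t. t \<in> ty ` I \<Longrightarrow> word_equiv (prod_cat {i\<in>I. ty i = t} A) (\<Pi>\<^sub>E i\<in>{i\<in>I. ty i = t}. S i)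
      (map_word (\<lambda>f. restrict f {i\<in>I. ty i = t}) P) (map_word (\<lambda>f. restrict f {i\<in>I. ty i = t}) Q)"
  shows "word_equiv (prod_cat I A) (\<Pi>\<^sub>E i\<in>I. S i) P Q"
  using assms
proof (induction T arbitrary: I P Q rule: finite_induct)
  case empty
  interpret marked_family I A S
    by fact
  show ?case
    using rel_empty_family empty by simp
next
  case (insert t T)
  interpret marked_family I A S
    by fact
  define J where "J = {i \<in> I. ty i = t}"
  have J: "J \<subseteq> I" and K: "I - J \<subseteq> I"
    by (auto simp: J_def)
  interpret J: marked_family J A S
    using J by (rule subfamily)
  interpret K: marked_family "I - J" A S
    using K by (rule subfamily)
  interpret rJ: marked_functor M \<Sigma> J.M J.\<Sigma> "\<lambda>X. restrict X J" "\<lambda>f. restrict f J"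
    using J by (rule restriction)
  interpret rK: marked_functor M \<Sigma> K.M K.\<Sigma> "\<lambda>X. restrict X (I - J)" "\<lambda>f. restrict f (I - J)"
    using K by (rule restriction)
  show ?case
  proof (rule rel_glue_two[OF J])
    show "word_equiv J.M J.\<Sigma> (restrict_word J P) (restrict_word J Q)"
    proof (cases "J = {}")
      case True
      then show ?thesis
        using J.rel_empty_family insert.prems rJ.map_word_in by blast
    next
      case False
      then have "t \<in> ty ` I"
        by (auto simp: J_def)
      then show ?thesis
        using insert.prems(5)[of t] by (simp only: J_def)
    qed
    show "word_equiv K.M K.\<Sigma> (restrict_word (I - J) P) (restrict_word (I - J) Q)"
    proof (rule insert.IH)
      show "marked_family (I - J) A S" ..
      show "ty ` (I - J) \<subseteq> T"
        using insert.prems(2) by (auto simp: J_def)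
      show "restrict_word (I - J) P \<in> words K.M K.\<Sigma>" "restrict_word (I - J) Q \<in> words K.M K.\<Sigma>"
        using insert.prems by simp_all
      fix u assume u: "u \<in> ty ` (I - J)"
      then have eq: "{i \<in> I - J. ty i = u} = {i \<in> I. ty i = u}"
        by (auto simp: J_def)
      have sub: "{i \<in> I. ty i = u} \<subseteq> I - J"
        using eq by auto
      show "word_equiv (prod_cat {i \<in> I - J. ty i = u} A) (\<Pi>\<^sub>E i\<in>{i \<in> I - J. ty i = u}. S i)
        (restrict_word {i \<in> I - J. ty i = u} (restrict_word (I - J) P))
        (restrict_word {i \<in> I - J. ty i = u} (restrict_word (I - J) Q))"
        unfolding eq restrict_restrict_word[OF sub] using u by (intro insert.prems(5)) auto
    qed
  qed (use insert.prems in auto)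
qed

section \<open>Words of a product\<close>

abbreviation proj :: "'i \<Rightarrow> ('i \<Rightarrow> 'm) arrow list \<Rightarrow> 'm arrow list" where
  "proj i \<equiv> map_word (\<lambda>f. f i)"

text \<open>The pattern of forward and backward arrows, encoded as a word over the one-element type.\<close>

definition shape :: "'m arrow list \<Rightarrow> unit arrow list" where
  "shape P = map_word (\<lambda>_. ()) P"

lemma length_shape [simp]: "length (shape P) = length P"
  by (simp add: shape_def)

lemma shape_eq_Nil_iff [simp]: "shape P = [] \<longleftrightarrow> P = []"
  by (simp add: shape_def)

lemma shape_map [simp]: "shape (map_word h P) = shape P"
  by (simp add: shape_def arrow.map_comp comp_def)

lemma proj_restrict_word: "i \<in> J \<Longrightarrow> proj i (map_word (\<lambda>f. restrict f J) P) = proj i P"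
  by (simp add: arrow.map_comp comp_def)

lemma finite_shapes: "finite {\<sigma> :: unit arrow list. length \<sigma> \<le> n}"
proof -
  have "(a :: unit arrow) \<in> {Fwd (), Bwd ()}" for a
    by (cases a) auto
  then have "finite (UNIV :: unit arrow set)"
    by (metis UNIV_I finite.emptyI finite.insertI finite_subset subsetI)
  then show ?thesis
    using finite_lists_length_le[of "UNIV :: unit arrow set" n] by simp
qed

text \<open>Only for a nonempty index set do the coordinates determine whether an arrow is forward or backward.\<close>

lemma PiE_arrow_ext:
  assumes "I \<noteq> {}" "a \<in> arrows (prod_cat I A) (\<Pi>\<^sub>E i\<in>I. S i)" "b \<in> arrows (prod_cat I A) (\<Pi>\<^sub>E i\<in>I. S i)"
    and "\<And>i. i \<in> I \<Longrightarrow> map_arrow (\<lambda>f. f i) a = map_arrow (\<lambda>f. f i) b"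
  shows "a = b"
proof -
  obtain i where i: "i \<in> I"
    using assms(1) by auto
  have ext: "f = g" if "f \<in> (\<Pi>\<^sub>E i\<in>I. B i)" "g \<in> (\<Pi>\<^sub>E i\<in>I. B i)" "\<And>i. i \<in> I \<Longrightarrow> f i = g i"
    for f g and B :: "_ \<Rightarrow> _ set"
    using that by (rule PiE_ext)
  show ?thesis
  proof (cases a; cases b)
    fix f g assume "a = Fwd f" "b = Fwd g"
    then show ?thesis
      using assms(2-4) ext[of f "\<lambda>i. Mor (A i)" g] by (simp add: prod_cat_simps)
  next
    fix f g assume "a = Bwd f" "b = Bwd g"
    then show ?thesis
      using assms(2-4) ext[of f S g] by simp
  qed (use assms(4)[OF i] in simp_all)
qed

lemma PiE_word_ext:
  assumes "I \<noteq> {}"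
    and "set P \<subseteq> arrows (prod_cat I A) (\<Pi>\<^sub>E i\<in>I. S i)" "set Q \<subseteq> arrows (prod_cat I A) (\<Pi>\<^sub>E i\<in>I. S i)"
    and eq: "\<And>i. i \<in> I \<Longrightarrow> proj i P = proj i Q"
  shows "P = Q"
proof -
  obtain i where "i \<in> I"
    using assms(1) by auto
  then have len: "length P = length Q"
    using eq map_eq_imp_length_eq by blast
  then show ?thesis
    using assms(2,3) eq
  proof (induction P Q rule: list_induct2)
    case (Cons a P b Q)
    then show ?case
      using PiE_arrow_ext[OF assms(1), of a A S b] by simp
  qed simp
qed

context marked_family
begin

lemma product_arrow:
  assumes "\<And>i. i \<in> I \<Longrightarrow> a i \<in> arrows (A i) (S i) \<and> map_arrow (\<lambda>_. ()) (a i) = c"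
  obtains b where "b \<in> arrows M \<Sigma>" "map_arrow (\<lambda>_. ()) b = c"
    "\<And>i. i \<in> I \<Longrightarrow> map_arrow (\<lambda>f. f i) b = a i"
proof (cases c)
  case (Fwd u)
  then have "\<forall>i\<in>I. \<exists>f. f \<in> Mor (A i) \<and> a i = Fwd f"
    using assms by (metis Fwd_arrows arrow.exhaust arrow.distinct(1) arrow.map(2))
  then obtain f where "\<forall>i\<in>I. f i \<in> Mor (A i) \<and> a i = Fwd (f i)"
    by metis
  then show ?thesis
    using Fwd by (intro that[of "Fwd (restrict f I)"]) (auto simp: prod_cat_simps)
next
  case (Bwd u)
  then have "\<forall>i\<in>I. \<exists>f. f \<in> S i \<and> a i = Bwd f"
    using assms by (metis Bwd_arrows arrow.exhaust arrow.distinct(1) arrow.map(1))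
  then obtain f where "\<forall>i\<in>I. f i \<in> S i \<and> a i = Bwd (f i)"
    by metis
  then show ?thesis
    using Bwd by (intro that[of "Bwd (restrict f I)"]) auto
qed

lemma product_word:
  assumes "\<sigma> \<noteq> []" "\<And>i. i \<in> I \<Longrightarrow> w i \<in> words (A i) (S i) \<and> shape (w i) = \<sigma>"
  obtains W where "W \<in> words M \<Sigma>" "shape W = \<sigma>" "\<And>i. i \<in> I \<Longrightarrow> proj i W = w i"
proof -
  have "\<exists>W. W \<in> words M \<Sigma> \<and> shape W = \<sigma> \<and> (\<forall>i\<in>I. proj i W = w i)"
    using assms
  proof (induction \<sigma> arbitrary: w rule: list_nonempty_induct)
    case (single c)
    have "\<forall>i\<in>I. \<exists>a. w i = [a] \<and> a \<in> arrows (A i) (S i) \<and> map_arrow (\<lambda>_. ()) a = c"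
      using single by (fastforce simp: shape_def)
    then obtain a where a: "\<forall>i\<in>I. w i = [a i] \<and> a i \<in> arrows (A i) (S i) \<and> map_arrow (\<lambda>_. ()) (a i) = c"
      by metis
    then obtain b where "b \<in> arrows M \<Sigma>" "map_arrow (\<lambda>_. ()) b = c"
        "\<And>i. i \<in> I \<Longrightarrow> map_arrow (\<lambda>f. f i) b = a i"
      using product_arrow[of a c] by blast
    then show ?case
      using a by (intro exI[of _ "[b]"]) (simp add: shape_def)
  next
    case (cons c \<sigma>)
    have "\<forall>i\<in>I. \<exists>a v. w i = a # v \<and> v \<in> words (A i) (S i) \<and> shape v = \<sigma> \<and>
        asource (A i) a = wtarget (A i) v \<and> a \<in> arrows (A i) (S i) \<and> map_arrow (\<lambda>_. ()) a = c"
    proof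
      fix i assume "i \<in> I"
      then have w: "w i \<in> words (A i) (S i)" "shape (w i) = c # \<sigma>"
        using cons.prems by auto
      then obtain a v where av: "w i = a # v" "shape v = \<sigma>" "map_arrow (\<lambda>_. ()) a = c"
        by (auto simp: shape_def)
      then have "v \<noteq> []"
        using cons.hyps by auto
      then show "\<exists>a v. w i = a # v \<and> v \<in> words (A i) (S i) \<and> shape v = \<sigma> \<and>
          asource (A i) a = wtarget (A i) v \<and> a \<in> arrows (A i) (S i) \<and> map_arrow (\<lambda>_. ()) a = c"
        using w av by (auto simp: words_Cons)
    qed
    then obtain a v where av: "\<forall>i\<in>I. w i = a i # v i \<and> v i \<in> words (A i) (S i) \<and> shape (v i) = \<sigma> \<and>
        asource (A i) (a i) = wtarget (A i) (v i) \<and> a i \<in> arrows (A i) (S i) \<and>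
        map_arrow (\<lambda>_. ()) (a i) = c"
      by metis
    then obtain b where b: "b \<in> arrows M \<Sigma>" "map_arrow (\<lambda>_. ()) b = c"
        "\<And>i. i \<in> I \<Longrightarrow> map_arrow (\<lambda>f. f i) b = a i"
      using product_arrow[of a c] by blast
    obtain V where V: "V \<in> words M \<Sigma>" "shape V = \<sigma>" "\<forall>i\<in>I. proj i V = v i"
      using cons.IH[of v] av by blast
    have ne: "V \<noteq> []"
      using V(1) by (rule words_nonempty)
    have "asource M b = wtarget M V"
    proof (rule PiE_ext)
      show "asource M b \<in> (\<Pi>\<^sub>E i\<in>I. Obj (A i))" "wtarget M V \<in> (\<Pi>\<^sub>E i\<in>I. Obj (A i))"
        using prod.asource_in[OF b(1)] prod.wtarget_in[OF V(1)] by (simp_all add: prod_cat_simps)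
      fix i assume i: "i \<in> I"
      interpret p: marked_functor M \<Sigma> "A i" "S i" "\<lambda>X. X i" "\<lambda>f. f i"
        using i by (rule projection)
      show "asource M b i = wtarget M V i"
        using p.asource_map[OF b(1)] p.wtarget_map[OF V(1)] b(3)[OF i] V(3) av i by simp
    qed
    then show ?case
      using V av b ne by (intro exI[of _ "b # V"]) (simp add: shape_def words_Cons)
  qed
  then show ?thesis
    using that by blast
qed

text \<open>The coordinates of a word share one pattern, so it suffices that the patterns of \<open>l\<close> and \<open>r\<close>
  determine the rule. The only overlap is that of two forward arrows becoming one, where
  the unit rules are instances of the composition rule by the unit laws of the category.\<close>

lemma elem_rule_product:
  assumes ne: "I \<noteq> {}" and lr: "set l \<subseteq> arrows M \<Sigma>" "set r \<subseteq> arrows M \<Sigma>"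
    and rule: "\<And>i. i \<in> I \<Longrightarrow> elem_rule (A i) (S i) (proj i l) (proj i r)"
  shows "elem_rule M \<Sigma> l r"
proof -
  have c: "category (A i)" if "i \<in> I" for i
    using marked_cat[OF that] by (rule marked_category.axioms)
  obtain i0 where i0: "i0 \<in> I"
    using ne by auto
  obtain a b d where abd: "l = [a, b]" "r = [d]"
    using elem_rule_length[OF rule[OF i0]] by (auto simp: numeral_2_eq_2 length_Suc_conv)
  have ext: "x = y" if "x \<in> extensional I" "y \<in> extensional I" "\<And>i. i \<in> I \<Longrightarrow> x i = y i"
    for x y :: "'i \<Rightarrow> 'm"
    using that by (metis extensionalityI)
  note r0 = rule[OF i0]
  show ?thesis
  proof (cases a; cases b; cases d)
    fix g f h assume s: "a = Fwd g" "b = Fwd f" "d = Fwd h"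
    have *: "f i \<in> Mor (A i) \<and> g i \<in> Mor (A i) \<and> source (A i) (g i) = target (A i) (f i) \<and>
        h i = cmp (A i) (g i) (f i)" if i: "i \<in> I" for i
      using rule[OF i] abd s
      by (auto elim!: elem_rule.cases
          simp: c[OF i, THEN category.ident_cmp] c[OF i, THEN category.cmp_ident]
          c[OF i, THEN category.target_in] c[OF i, THEN category.source_in]
          c[OF i, THEN category.ident_in] c[OF i, THEN category.source_ident]
          c[OF i, THEN category.target_ident])
    have "h = cmp M g f"
      by (rule ext) (use * lr abd s in \<open>auto simp: prod_cat_simps PiE_iff\<close>)
    then show ?thesis
      unfolding abd s by simp (rule rule_cmp, use * lr abd s in \<open>auto simp: prod_cat_simps\<close>)
  next
    fix g s t assume s: "a = Fwd g" "b = Bwd s" "d = Bwd t"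
    have *: "g i = ident (A i) (source (A i) (s i)) \<and> s i = t i" if i: "i \<in> I" for i
      using rule[OF i] abd s by (auto elim!: elem_rule.cases)
    have "g = ident M (source M s)" "t = s"
      by (rule ext; use * lr abd s in \<open>auto simp: prod_cat_simps PiE_iff\<close>)+
    then show ?thesis
      using rule_ident_left[of b M \<Sigma>] lr abd s by simp
  next
    fix g s t assume s: "a = Bwd s" "b = Fwd g" "d = Bwd t"
    have *: "g i = ident (A i) (target (A i) (s i)) \<and> s i = t i" if i: "i \<in> I" for i
      using rule[OF i] abd s by (auto elim!: elem_rule.cases)
    have "g = ident M (target M s)" "t = s"
      by (rule ext; use * lr abd s in \<open>auto simp: prod_cat_simps PiE_iff\<close>)+
    then show ?thesis
      using rule_ident_right[of a M \<Sigma>] lr abd s by simp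
  next
    fix s t g assume s: "a = Fwd s" "b = Bwd t" "d = Fwd g"
    have *: "g i = ident (A i) (target (A i) (s i)) \<and> s i = t i" if i: "i \<in> I" for i
      using rule[OF i] abd s by (auto elim!: elem_rule.cases)
    have "g = ident M (target M s)" "t = s"
      by (rule ext; use * lr abd s in \<open>auto simp: prod_cat_simps PiE_iff\<close>)+
    then show ?thesis
      using rule_inv_right[of s \<Sigma> M] lr abd s by simp
  next
    fix s t g assume s: "a = Bwd s" "b = Fwd t" "d = Fwd g"
    have *: "g i = ident (A i) (source (A i) (s i)) \<and> s i = t i" if i: "i \<in> I" for i
      using rule[OF i] abd s by (auto elim!: elem_rule.cases)
    have "g = ident M (source M s)" "t = s"
      by (rule ext; use * lr abd s in \<open>auto simp: prod_cat_simps PiE_iff\<close>)+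
    then show ?thesis
      using rule_inv_left[of s \<Sigma> M] lr abd s by simp
  qed (use r0 abd in \<open>auto elim: elem_rule.cases\<close>)
qed

end

section \<open>Rewriting all coordinates\<close>

text \<open>The position is recorded, and the direction fixed, so that steps in different coordinates can be
  compared.\<close>

definition contracts_at :: "nat \<Rightarrow> ('o, 'm) cat \<Rightarrow> 'm set \<Rightarrow> 'm arrow list \<Rightarrow> 'm arrow list \<Rightarrow> bool" where
  "contracts_at n C S P Q \<longleftrightarrow>
    (\<exists>U l r V. length U = n \<and> P = U @ l @ V \<and> Q = U @ r @ V \<and> elem_rule C S l r)"

lemma contracts_at_length: "contracts_at n C S P Q \<Longrightarrow> n < length Q \<and> length P = Suc (length Q)"
  by (auto simp: contracts_at_def dest!: elem_rule_length)

text \<open>A description by \<open>take\<close> and \<open>drop\<close>, with which the decompositions found in the single coordinates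
  turn out to be projections of one decomposition over the product.\<close>

lemma contracts_at_iff:
  "contracts_at n C S P Q \<longleftrightarrow> take n P = take n Q \<and> drop (n + 2) P = drop (n + 1) Q \<and>
    elem_rule C S (take 2 (drop n P)) (take 1 (drop n Q))"
proof
  assume "contracts_at n C S P Q"
  then obtain U l r V where w: "length U = n" "P = U @ l @ V" "Q = U @ r @ V" and lr: "elem_rule C S l r"
    by (auto simp: contracts_at_def)
  then show "take n P = take n Q \<and> drop (n + 2) P = drop (n + 1) Q \<and>
    elem_rule C S (take 2 (drop n P)) (take 1 (drop n Q))"
    using elem_rule_length[OF lr] by simp
next
  assume *: "take n P = take n Q \<and> drop (n + 2) P = drop (n + 1) Q \<and>
    elem_rule C S (take 2 (drop n P)) (take 1 (drop n Q))"
  then have "length (take 2 (drop n P)) = 2"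
    using elem_rule_length by blast
  then have "length (take n P) = n"
    by (auto simp: min_def split: if_splits)
  moreover have "P = take n P @ take 2 (drop n P) @ drop (n + 2) P"
    by (metis add.commute append_take_drop_id drop_drop)
  moreover have "Q = take n Q @ take 1 (drop n Q) @ drop (n + 1) Q"
    by (metis add.commute append_take_drop_id drop_drop)
  ultimately show "contracts_at n C S P Q"
    unfolding contracts_at_def using * by metis
qed

lemma contracts_at_step:
  "P \<in> words C S \<Longrightarrow> Q \<in> words C S \<Longrightarrow> contracts_at n C S P Q \<Longrightarrow> rewrite_step C S P Q"
  unfolding contracts_at_def rewrite_step_def by blast

lemma (in marked_family) contracts_at_product:
  assumes ne: "I \<noteq> {}" and PQ: "P \<in> words M \<Sigma>" "Q \<in> words M \<Sigma>"
    and c: "\<And>i. i \<in> I \<Longrightarrow> contracts_at n (A i) (S i) (proj i P) (proj i Q)"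
  shows "contracts_at n M \<Sigma> P Q"
proof -
  have P: "set P \<subseteq> arrows M \<Sigma>" and Q: "set Q \<subseteq> arrows M \<Sigma>"
    using PQ words_arrows by blast+
  have "take n P = take n Q"
    by (rule PiE_word_ext[where A = A and S = S, OF ne])
      (use P Q c in \<open>auto dest: in_set_takeD in_set_dropD simp: contracts_at_iff take_map simp flip: map_append\<close>)
  moreover have "drop (n + 2) P = drop (n + 1) Q"
    by (rule PiE_word_ext[where A = A and S = S, OF ne])
      (use P Q c in \<open>auto dest: in_set_takeD in_set_dropD simp: contracts_at_iff drop_map\<close>)
  moreover have "elem_rule M \<Sigma> (take 2 (drop n P)) (take 1 (drop n Q))"
    by (rule elem_rule_product[OF ne])
      (use P Q c in \<open>auto dest!: in_set_takeD in_set_dropD simp: contracts_at_iff take_map drop_map\<close>)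
  ultimately show ?thesis
    by (simp add: contracts_at_iff)
qed

text \<open>The finite information about a step on which different coordinates have to agree before their steps
  form a step over the product. \<open>Stay\<close> accounts for coordinates that are already rewritten.\<close>

datatype move = Stay | Contract nat | Expand nat

fun moves :: "move \<Rightarrow> ('o, 'm) cat \<Rightarrow> 'm set \<Rightarrow> 'm arrow list \<Rightarrow> 'm arrow list \<Rightarrow> bool" where
  "moves Stay C S P Q \<longleftrightarrow> P = Q"
| "moves (Contract n) C S P Q \<longleftrightarrow> contracts_at n C S P Q"
| "moves (Expand n) C S P Q \<longleftrightarrow> contracts_at n C S Q P"

lemma rewrite_step_moves:
  assumes "rewrite_step C S P Q"
  obtains m where "moves m C S P Q" "m \<in> {Stay} \<union> Contract ` {..length P} \<union> Expand ` {..length P}"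
    "length Q \<le> Suc (length P)"
proof -
  obtain U V l r where PQ: "P = U @ l @ V" "Q = U @ r @ V"
      and "elem_rule C S l r \<or> elem_rule C S r l"
    using assms by (auto simp: rewrite_step_def)
  then consider "contracts_at (length U) C S P Q" | "contracts_at (length U) C S Q P"
    unfolding contracts_at_def by blast
  then show ?thesis
  proof cases
    case 1
    then show ?thesis
      using contracts_at_length[OF 1] PQ by (intro that[of "Contract (length U)"]) auto
  next
    case 2
    then show ?thesis
      using contracts_at_length[OF 2] PQ by (intro that[of "Expand (length U)"]) auto
  qed
qed

lemma (in marked_family) moves_product:
  assumes ne: "I \<noteq> {}" and PQ: "P \<in> words M \<Sigma>" "Q \<in> words M \<Sigma>"
    and m: "\<And>i. i \<in> I \<Longrightarrow> moves m (A i) (S i) (proj i P) (proj i Q)"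
  shows "prod.rel P Q"
proof (cases m)
  case Stay
  then have "P = Q"
    using PiE_word_ext[OF ne words_arrows[OF PQ(1)] words_arrows[OF PQ(2)]] m Stay by simp
  then show ?thesis
    using PQ by (simp add: prod.rel_refl)
next
  case (Contract n)
  then show ?thesis
    using contracts_at_product[OF ne PQ, of n] m contracts_at_step PQ prod.step_rel by fastforce
next
  case (Expand n)
  then show ?thesis
    using contracts_at_product[OF ne PQ(2,1), of n] m contracts_at_step PQ prod.step_rel
      prod.rel_sym by fastforce
qed

text \<open>The induction has to vary the index set, because the first step is performed on blocks of indices
  with equal moves and equal patterns of the word reached.\<close>

lemma rel_if_bounded:
  assumes "marked_family I A S"
    and "P \<in> words (prod_cat I A) (\<Pi>\<^sub>E i\<in>I. S i)" "Q \<in> words (prod_cat I A) (\<Pi>\<^sub>E i\<in>I. S i)"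
    and "\<And>i. i \<in> I \<Longrightarrow> \<exists>n\<le>D. (rewrite_step (A i) (S i) ^^ n) (proj i P) (proj i Q)"
  shows "word_equiv (prod_cat I A) (\<Pi>\<^sub>E i\<in>I. S i) P Q"
  using assms
proof (induction D arbitrary: I P Q)
  case 0
  then interpret marked_family I A S
    by simp
  show ?case
  proof (cases "I = {}")
    case True
    then show ?thesis
      using rel_empty_family 0 by blast
  next
    case False
    then show ?thesis
      using moves_product[OF False, of P Q Stay] 0 by simp
  qed
next
  case (Suc D)
  then interpret marked_family I A S
    by simp
  let ?m = "{Stay} \<union> Contract ` {..length P} \<union> Expand ` {..length P}"
  have "\<forall>i\<in>I. \<exists>R m. R \<in> words (A i) (S i) \<and> moves m (A i) (S i) (proj i P) R \<and> m \<in> ?m \<and>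
    length R \<le> Suc (length P) \<and> (\<exists>n\<le>D. (rewrite_step (A i) (S i) ^^ n) R (proj i Q))"
  proof
    fix i assume i: "i \<in> I"
    interpret p: marked_functor M \<Sigma> "A i" "S i" "\<lambda>X. X i" "\<lambda>f. f i"
      using i by (rule projection)
    obtain n where n: "n \<le> Suc D" "(rewrite_step (A i) (S i) ^^ n) (proj i P) (proj i Q)"
      using Suc.prems(4)[OF i] by blast
    have w: "proj i P \<in> words (A i) (S i)"
      using Suc.prems(2) by simp
    show "\<exists>R m. R \<in> words (A i) (S i) \<and> moves m (A i) (S i) (proj i P) R \<and> m \<in> ?m \<and>
        length R \<le> Suc (length P) \<and> (\<exists>n\<le>D. (rewrite_step (A i) (S i) ^^ n) R (proj i Q))"
    proof (cases n)
      case 0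
      then show ?thesis
        using n w
        by (intro exI[of _ "proj i P"] exI[of _ Stay]) (auto dest: map_eq_imp_length_eq)
    next
      case (Suc k)
      then obtain R where R: "rewrite_step (A i) (S i) (proj i P) R"
          "(rewrite_step (A i) (S i) ^^ k) R (proj i Q)"
        using n(2) by (metis relpowp_Suc_D2)
      moreover obtain m where "moves m (A i) (S i) (proj i P) R" "m \<in> ?m"
          "length R \<le> Suc (length P)"
        using rewrite_step_moves[OF R(1)] by auto
      moreover have "R \<in> words (A i) (S i)" "k \<le> D"
        using R(1) n(1) Suc by (auto simp: rewrite_step_def)
      ultimately show ?thesis
        by blast
    qed
  qed
  then obtain R m where Rm: "\<And>i. i \<in> I \<Longrightarrow> R i \<in> words (A i) (S i) \<and>
      moves (m i) (A i) (S i) (proj i P) (R i) \<and> m i \<in> ?m \<and>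
      length (R i) \<le> Suc (length P) \<and> (\<exists>n\<le>D. (rewrite_step (A i) (S i) ^^ n) (R i) (proj i Q))"
    by metis
  \<comment> \<open>Indices with equal values form the blocks on which the first steps fit together.\<close>
  define ty where "ty i = (m i, shape (R i))" for i
  show ?case
  proof (rule rel_glue_finite)
    show "finite (?m \<times> {\<sigma> :: unit arrow list. length \<sigma> \<le> Suc (length P)})"
      using finite_shapes by blast
    show "ty ` I \<subseteq> ?m \<times> {\<sigma> :: unit arrow list. length \<sigma> \<le> Suc (length P)}"
      using Rm by (auto simp: ty_def)
    fix t assume t: "t \<in> ty ` I"
    define J where "J = {i \<in> I. ty i = t}"
    have J: "J \<subseteq> I" "J \<noteq> {}"
      using t by (auto simp: J_def)
    interpret J: marked_family J A S
      using J(1) by (rule subfamily)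
    interpret r: marked_functor M \<Sigma> J.M J.\<Sigma> "\<lambda>X. restrict X J" "\<lambda>f. restrict f J"
      using J(1) by (rule restriction)
    obtain \<mu> \<sigma> where \<mu>: "t = (\<mu>, \<sigma>)"
      by (cases t)
    have ty: "m i = \<mu>" "shape (R i) = \<sigma>" "i \<in> I" if "i \<in> J" for i
      using that \<mu> by (auto simp: J_def ty_def)
    \<comment> \<open>On the block J all first steps are the move \<mu> and reach words of pattern \<sigma>.\<close>
    have "\<sigma> \<noteq> []"
      using J(2) Rm ty words_nonempty by (metis all_not_in_conv shape_eq_Nil_iff)
    then obtain W where W: "W \<in> words J.M J.\<Sigma>" "\<And>i. i \<in> J \<Longrightarrow> proj i W = R i"
    proof (rule J.product_word[of \<sigma> R])
      show "R i \<in> words (A i) (S i) \<and> shape (R i) = \<sigma>" if "i \<in> J" for i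
        using Rm[OF ty(3)[OF that]] ty(2)[OF that] by blast
    qed blast
    have "J.prod.rel (map_word (\<lambda>f. restrict f J) P) W"
    proof (rule J.moves_product[OF J(2) r.map_word_in[OF Suc.prems(2)] W(1)])
      show "moves \<mu> (A i) (S i) (proj i (map_word (\<lambda>f. restrict f J) P)) (proj i W)" if "i \<in> J" for i
        unfolding W(2)[OF that] proj_restrict_word[OF that]
        using Rm[OF ty(3)[OF that]] ty(1)[OF that] by simp
    qed
    moreover have "J.prod.rel W (map_word (\<lambda>f. restrict f J) Q)"
    proof (rule Suc.IH[OF J.marked_family_axioms W(1) r.map_word_in[OF Suc.prems(3)]])
      show "\<exists>n\<le>D. (rewrite_step (A i) (S i) ^^ n) (proj i W) (proj i (map_word (\<lambda>f. restrict f J) Q))"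
        if "i \<in> J" for i
        unfolding W(2)[OF that] proj_restrict_word[OF that]
        using Rm[OF ty(3)[OF that]] by simp
    qed
    ultimately have "J.prod.rel (map_word (\<lambda>f. restrict f J) P) (map_word (\<lambda>f. restrict f J) Q)"
      by (rule J.prod.rel_trans)
    then show "word_equiv (prod_cat {i \<in> I. ty i = t} A) (\<Pi>\<^sub>E i\<in>{i \<in> I. ty i = t}. S i)
      (map_word (\<lambda>f. restrict f {i \<in> I. ty i = t}) P) (map_word (\<lambda>f. restrict f {i \<in> I. ty i = t}) Q)"
      by (simp only: J_def)
  qed (use Suc.prems in auto)
qed

section \<open>The canonical functor\<close>

context marked_category
begin

text \<open>The uniqueness in the universal property: the image of a backward arrow is inverse to the
  image of a forward one, and inverses are unique.\<close>

lemma localization_functor_unique: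
  assumes "category D"
    and T: "is_functor (localization C S) D T" and T': "is_functor (localization C S) D T'"
    and eq: "functor_comp C T (loc_functor C S) = functor_comp C T' (loc_functor C S)"
  shows "T = T'"
proof -
  interpret D: category D
    by fact
  let ?L = "localization C S"
  have obj: "FObj T X = FObj T' X" if "X \<in> Obj C" for X
    using arg_cong[OF eq, of "\<lambda>F. FObj F X"] that
    by (simp add: functor_comp_def loc_functor_def compose_eq)
  have Fwd: "FMor T (word_class C S [Fwd f]) = FMor T' (word_class C S [Fwd f])" if "f \<in> Mor C" for f
    using arg_cong[OF eq, of "\<lambda>F. FMor F f"] that
    by (simp add: functor_comp_def loc_functor_def compose_eq)
  have fct: "FMor F c \<in> Mor D" "source D (FMor F c) = FObj F (source ?L c)"
    "target D (FMor F c) = FObj F (target ?L c)"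
    "d \<in> Mor ?L \<Longrightarrow> source ?L d = target ?L c \<Longrightarrow> FMor F (cmp ?L d c) = cmp D (FMor F d) (FMor F c)"
    if "is_functor ?L D F" "c \<in> Mor ?L" for F c d
    using that by (auto simp: is_functor_def)
  have ident: "FMor F (word_class C S [Fwd (ident C X)]) = ident D (FObj F X)"
    if "is_functor ?L D F" "X \<in> Obj C" for F X
    using that by (auto simp: is_functor_def)
  have Bwd: "FMor T (word_class C S [Bwd s]) = FMor T' (word_class C S [Bwd s])" if s: "s \<in> S" for s
  proof -
    let ?u = "FMor T (word_class C S [Bwd s])" and ?v = "FMor T' (word_class C S [Bwd s])"
    let ?w = "FMor T (word_class C S [Fwd s])"
    have l: "word_class C S [Bwd s] \<in> Mor ?L" "word_class C S [Fwd s] \<in> Mor ?L"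
      using s by simp_all
    have ends: "source D ?u = FObj T (target C s)" "target D ?u = FObj T (source C s)"
      "source D ?v = FObj T (target C s)" "target D ?v = FObj T (source C s)"
      "source D ?w = FObj T (source C s)" "target D ?w = FObj T (target C s)"
      using fct(2,3)[OF T l(1)] fct(2,3)[OF T' l(1)] fct(2,3)[OF T l(2)] s obj by simp_all
    have "cmp D ?w ?u = FMor T (cmp ?L (word_class C S [Fwd s]) (word_class C S [Bwd s]))"
      using fct(4)[OF T l(1) l(2)] s by simp
    also have "\<dots> = FMor T (word_class C S [Fwd (ident C (target C s))])"
      using word_class_eqI[OF elem_rel[OF rule_inv_right[OF s]]] s by simp
    also have "\<dots> = ident D (FObj T (target C s))"
      using ident[OF T] s by simp
    finally have wu: "cmp D ?w ?u = ident D (FObj T (target C s))" .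
    have "cmp D ?v ?w = FMor T' (cmp ?L (word_class C S [Bwd s]) (word_class C S [Fwd s]))"
      using fct(4)[OF T' l(2) l(1)] s Fwd by simp
    also have "\<dots> = FMor T' (word_class C S [Fwd (ident C (source C s))])"
      using word_class_eqI[OF elem_rel[OF rule_inv_left[OF s]]] s by simp
    also have "\<dots> = ident D (FObj T (source C s))"
      using ident[OF T'] s obj by simp
    finally have vw: "cmp D ?v ?w = ident D (FObj T (source C s))" .
    have m: "?u \<in> Mor D" "?v \<in> Mor D" "?w \<in> Mor D"
      using fct(1)[OF T l(1)] fct(1)[OF T' l(1)] fct(1)[OF T l(2)] by simp_all
    have "?v = cmp D ?v (cmp D ?w ?u)"
      using wu D.cmp_ident[OF m(2)] ends by simp
    also have "\<dots> = cmp D (cmp D ?v ?w) ?u"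
      using D.cmp_assoc[OF m(1,3,2)] ends by simp
    also have "\<dots> = ?u"
      using vw D.ident_cmp[OF m(1)] ends by simp
    finally show ?thesis
      by simp
  qed
  have arrow: "FMor T (word_class C S [a]) = FMor T' (word_class C S [a])" if "a \<in> arrows C S" for a
    using that Fwd Bwd by (cases a) auto
  have word: "FMor T (word_class C S P) = FMor T' (word_class C S P)" if P: "P \<in> words C S" for P
  proof -
    have "P \<noteq> []"
      using P by (rule words_nonempty)
    then show ?thesis
      using P
    proof (induction P rule: list_nonempty_induct)
      case (single a)
      then show ?case
        using arrow by simp
    next
      case (cons a P)
      have a: "[a] \<in> words C S" and P: "P \<in> words C S" and aP: "wsource C [a] = wtarget C P"
        using cons by (auto simp: words_Cons)
      have l: "word_class C S [a] \<in> Mor ?L" "word_class C S P \<in> Mor ?L"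
        "source ?L (word_class C S [a]) = target ?L (word_class C S P)"
        using a P aP by (simp_all del: words_single)
      show ?case
        using cmp_localization[OF P a aP] fct(4)[OF T l(2,1,3)] fct(4)[OF T' l(2,1,3)]
          cons.IH[OF P] arrow a by simp
    qed
  qed
  have "FObj T = FObj T'"
    by (rule PiE_ext[of _ "Obj C" "\<lambda>_. Obj D"]) (use T T' obj in \<open>auto simp: is_functor_def\<close>)
  moreover have "FMor T = FMor T'"
    by (rule PiE_ext[of _ "Mor ?L" "\<lambda>_. Mor D"])
      (use T T' word in \<open>auto simp: is_functor_def elim!: localization_morE\<close>)
  ultimately show ?thesis
    by simp
qed

end

context marked_family
begin

abbreviation "Loc \<equiv> localization M \<Sigma>"
abbreviation "Prod_Loc \<equiv> prod_cat I (\<lambda>i. localization (A i) (S i))"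

lemma wsource_proj: "i \<in> I \<Longrightarrow> P \<in> words M \<Sigma> \<Longrightarrow> wsource (A i) (proj i P) = wsource M P i"
  using marked_functor.wsource_map[OF projection] by metis

lemma wtarget_proj: "i \<in> I \<Longrightarrow> P \<in> words M \<Sigma> \<Longrightarrow> wtarget (A i) (proj i P) = wtarget M P i"
  using marked_functor.wtarget_map[OF projection] by metis

lemma proj_words: "i \<in> I \<Longrightarrow> P \<in> words M \<Sigma> \<Longrightarrow> proj i P \<in> words (A i) (S i)"
  using marked_functor.map_word_in[OF projection] by metis

lemma category_Prod_Loc: "category Prod_Loc"
  by (intro category_prod marked_category.category_localization marked_cat)

lemma Obj_Prod_Loc: "Obj Prod_Loc = Obj M"
  by (simp add: prod_cat_simps marked_category.Obj_localization[OF marked_cat] cong: PiE_cong)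

text \<open>The coordinates are those of a chosen representative. Rewriting the representative rewrites its
  coordinates, so the choice does not matter (\<open>theta_map_word\<close>).\<close>

definition theta_map where
  "theta_map = \<lparr>FObj = (\<lambda>X\<in>Obj M. X),
    FMor = (\<lambda>c\<in>Mor Loc. \<lambda>i\<in>I. word_class (A i) (S i) (proj i (SOME P. P \<in> c)))\<rparr>"

lemma theta_map_word:
  assumes P: "P \<in> words M \<Sigma>"
  shows "FMor theta_map (word_class M \<Sigma> P) = (\<lambda>i\<in>I. word_class (A i) (S i) (proj i P))"
proof -
  let ?Q = "SOME Q. Q \<in> word_class M \<Sigma> P"
  have "word_class (A i) (S i) (proj i ?Q) = word_class (A i) (S i) (proj i P)" if i: "i \<in> I" for i
    using marked_functor.word_equiv_map[OF projection[OF i] prod.some_representative[OF P]]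
    by (simp add: word_class_eqI)
  then show ?thesis
    using P by (simp add: theta_map_def restrict_eq_iff)
qed

lemma theta_map_functor: "is_functor Loc Prod_Loc theta_map"
  unfolding is_functor_def
proof (intro conjI ballI impI)
  show "FObj theta_map \<in> Obj Loc \<rightarrow>\<^sub>E Obj Prod_Loc"
    by (simp add: theta_map_def Obj_Prod_Loc)
  have word: "(\<lambda>i\<in>I. word_class (A i) (S i) (proj i P)) \<in> Mor Prod_Loc" if "P \<in> words M \<Sigma>" for P
    using marked_category.word_class_in_localization[OF marked_cat] proj_words[OF _ that]
    by (auto simp: prod_cat_simps)
  show "FMor theta_map \<in> Mor Loc \<rightarrow>\<^sub>E Mor Prod_Loc"
  proof (rule PiE_I)
    fix c assume "c \<in> Mor Loc"
    then obtain P where "P \<in> words M \<Sigma>" "c = word_class M \<Sigma> P"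
      by (rule prod.localization_morE)
    then show "FMor theta_map c \<in> Mor Prod_Loc"
      using word[of P] theta_map_word[of P] by simp
  qed (simp add: theta_map_def)
  fix X assume X: "X \<in> Obj Loc"
  have w: "[Fwd (ident M X)] \<in> words M \<Sigma>"
    using X by simp
  have "FMor theta_map (ident Loc X) = (\<lambda>i\<in>I. word_class (A i) (S i) [Fwd (ident (A i) (X i))])"
    using theta_map_word[OF w] by (simp add: prod_cat_simps(5) restrict_eq_iff)
  also have "\<dots> = ident Prod_Loc (FObj theta_map X)"
    using X marked_category.ident_localization[OF marked_cat]
    by (simp add: theta_map_def prod_cat_simps(5) restrict_eq_iff)
  finally show "FMor theta_map (ident Loc X) = ident Prod_Loc (FObj theta_map X)" .
next
  fix f assume "f \<in> Mor Loc"
  then obtain P where P: "P \<in> words M \<Sigma>" "f = word_class M \<Sigma> P"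
    by (rule prod.localization_morE)
  have e: "wsource M P \<in> extensional I" "wtarget M P \<in> extensional I"
    using prod.wsource_in[OF P(1)] prod.wtarget_in[OF P(1)] by (simp_all add: prod_cat_simps PiE_iff)
  have p: "proj i P \<in> words (A i) (S i)" if "i \<in> I" for i
    using proj_words[OF that P(1)] .
  have "source Prod_Loc (FMor theta_map f) = (\<lambda>i\<in>I. wsource M P i)"
    using P p marked_category.source_localization[OF marked_cat]
    by (simp add: theta_map_word prod_cat_simps restrict_eq_iff wsource_proj)
  then show "source Prod_Loc (FMor theta_map f) = FObj theta_map (source Loc f)"
    using P e by (simp add: theta_map_def extensional_restrict)
  have "target Prod_Loc (FMor theta_map f) = (\<lambda>i\<in>I. wtarget M P i)"
    using P p marked_category.target_localization[OF marked_cat]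
    by (simp add: theta_map_word prod_cat_simps restrict_eq_iff wtarget_proj)
  then show "target Prod_Loc (FMor theta_map f) = FObj theta_map (target Loc f)"
    using P e by (simp add: theta_map_def extensional_restrict)
  fix g assume "g \<in> Mor Loc" and gf: "source Loc g = target Loc f"
  then obtain Q where Q: "Q \<in> words M \<Sigma>" "g = word_class M \<Sigma> Q"
    by (auto elim: prod.localization_morE)
  have QP: "wsource M Q = wtarget M P"
    using gf P Q by simp
  have QP': "Q @ P \<in> words M \<Sigma>"
    using P Q QP by (simp add: words_append words_nonempty)
  show "FMor theta_map (cmp Loc g f) = cmp Prod_Loc (FMor theta_map g) (FMor theta_map f)"
    using P Q QP QP' p proj_words[OF _ Q(1)]
    by (simp add: theta_map_word prod_cat_simps restrict_eq_iff wsource_proj wtarget_proj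
      marked_category.cmp_localization[OF marked_cat])
qed

lemma theta_map_comp:
  "functor_comp M theta_map (loc_functor M \<Sigma>) = prod_functor I A (\<lambda>i. loc_functor (A i) (S i))"
proof -
  have "compose (Obj M) (FObj theta_map) (FObj (loc_functor M \<Sigma>)) X =
      (\<lambda>X\<in>Obj M. \<lambda>i\<in>I. FObj (loc_functor (A i) (S i)) (X i)) X" for X
    by (auto simp: compose_def theta_map_def loc_functor_def prod_cat_simps PiE_iff
      restrict_eq_extensional intro!: sym[of _ X])
  moreover have "compose (Mor M) (FMor theta_map) (FMor (loc_functor M \<Sigma>)) f =
      (\<lambda>f\<in>Mor M. \<lambda>i\<in>I. FMor (loc_functor (A i) (S i)) (f i)) f" for f
    by (auto simp: compose_def theta_map_word restrict_eq_iff loc_functor_def)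
      (auto simp: prod_cat_simps)
  ultimately show ?thesis
    unfolding functor_comp_def prod_functor_def by blast
qed

lemma theta_eq: "theta I A S = theta_map"
  unfolding theta_def
proof (rule the_equality)
  show "is_functor Loc Prod_Loc theta_map \<and>
    functor_comp M theta_map (loc_functor M \<Sigma>) = prod_functor I A (\<lambda>i. loc_functor (A i) (S i))"
    using theta_map_functor theta_map_comp by simp
  fix T assume "is_functor Loc Prod_Loc T \<and>
    functor_comp M T (loc_functor M \<Sigma>) = prod_functor I A (\<lambda>i. loc_functor (A i) (S i))"
  then show "T = theta_map"
    using prod.localization_functor_unique[OF category_Prod_Loc _ theta_map_functor] theta_map_comp by simp
qed

lemma faithful_theta_iff:
  "faithful Loc (theta I A S) \<longleftrightarrow> (\<forall>P\<in>words M \<Sigma>. \<forall>Q\<in>words M \<Sigma>.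
    (\<forall>i\<in>I. word_equiv (A i) (S i) (proj i P) (proj i Q)) \<longrightarrow> word_equiv M \<Sigma> P Q)"
proof -
  have same: "FMor theta_map (word_class M \<Sigma> P) = FMor theta_map (word_class M \<Sigma> Q) \<longleftrightarrow>
      (\<forall>i\<in>I. word_equiv (A i) (S i) (proj i P) (proj i Q))"
    if "P \<in> words M \<Sigma>" "Q \<in> words M \<Sigma>" for P Q
    using that by (simp add: theta_map_word restrict_eq_iff word_class_eq_iff proj_words)
  have ends: "wsource M P = wsource M Q" "wtarget M P = wtarget M Q"
    if PQ: "P \<in> words M \<Sigma>" "Q \<in> words M \<Sigma>"
      and e: "\<forall>i\<in>I. word_equiv (A i) (S i) (proj i P) (proj i Q)" for P Q
  proof -
    have "wsource M P i = wsource M Q i" "wtarget M P i = wtarget M Q i" if "i \<in> I" for i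
      using marked_category.rel_ends[OF marked_cat[OF that], of "proj i P" "proj i Q"] e that PQ
      by (simp_all add: wsource_proj wtarget_proj)
    moreover have "wsource M P \<in> (\<Pi>\<^sub>E i\<in>I. Obj (A i))" "wsource M Q \<in> (\<Pi>\<^sub>E i\<in>I. Obj (A i))"
      "wtarget M P \<in> (\<Pi>\<^sub>E i\<in>I. Obj (A i))" "wtarget M Q \<in> (\<Pi>\<^sub>E i\<in>I. Obj (A i))"
      using prod.wsource_in prod.wtarget_in PQ unfolding prod_cat_simps by blast+
    ultimately show "wsource M P = wsource M Q" "wtarget M P = wtarget M Q"
      using PiE_ext by blast+
  qed
  show ?thesis
    unfolding theta_eq
  proof
    assume f: "faithful Loc theta_map"
    show "\<forall>P\<in>words M \<Sigma>. \<forall>Q\<in>words M \<Sigma>.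
      (\<forall>i\<in>I. word_equiv (A i) (S i) (proj i P) (proj i Q)) \<longrightarrow> word_equiv M \<Sigma> P Q"
    proof (intro ballI impI)
      fix P Q assume PQ: "P \<in> words M \<Sigma>" "Q \<in> words M \<Sigma>"
        and e: "\<forall>i\<in>I. word_equiv (A i) (S i) (proj i P) (proj i Q)"
      then have "word_class M \<Sigma> P = word_class M \<Sigma> Q"
        using f ends[OF PQ e] same[OF PQ] unfolding faithful_def by simp
      then show "word_equiv M \<Sigma> P Q"
        using word_class_eq_iff PQ by blast
    qed
  next
    assume "\<forall>P\<in>words M \<Sigma>. \<forall>Q\<in>words M \<Sigma>.
      (\<forall>i\<in>I. word_equiv (A i) (S i) (proj i P) (proj i Q)) \<longrightarrow> word_equiv M \<Sigma> P Q"
    then show "faithful Loc theta_map"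
      unfolding faithful_def
      by (auto elim!: prod.localization_morE simp: same intro!: word_class_eqI simp del: word_class_eq_iff)
  qed
qed

end

section \<open>Distances\<close>

lemma rewrite_dist_steps:
  assumes "word_equiv C S P Q"
  shows "(rewrite_step C S ^^ rewrite_dist C S P Q) P Q"
proof -
  have "\<exists>n. (rewrite_step C S ^^ n) P Q"
    using assms by (auto simp: word_equiv_iff rtranclp_power)
  then show ?thesis
    unfolding rewrite_dist_def by (rule LeastI_ex)
qed

lemma rewrite_dist_le: "(rewrite_step C S ^^ n) P Q \<Longrightarrow> rewrite_dist C S P Q \<le> n"
  unfolding rewrite_dist_def by (rule Least_le)

lemma rewrite_bound_le_iff:
  "rewrite_bound C S L \<le> enat D \<longleftrightarrow> (\<forall>P Q. word_equiv C S P Q \<and> length P \<le> L \<and> length Q \<le> L \<longrightarrow>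
    rewrite_dist C S P Q \<le> D)"
proof -
  have pairs: "P \<in> words C S \<and> Q \<in> words C S \<and> word_class C S P = word_class C S Q \<and>
      length P \<le> L \<and> length Q \<le> L \<longleftrightarrow> word_equiv C S P Q \<and> length P \<le> L \<and> length Q \<le> L" for P Q
    using word_class_eq_iff[of P C S Q] word_equiv_words[of C S P Q] by blast
  define X where "X = {enat (rewrite_dist C S P Q) | P Q.
    word_equiv C S P Q \<and> length P \<le> L \<and> length Q \<le> L}"
  have X: "rewrite_bound C S L = Sup X"
    by (simp only: rewrite_bound_def X_def pairs)
  show ?thesis
  proof (intro iffI allI impI)
    fix P Q
    assume le: "rewrite_bound C S L \<le> enat D"
      and "word_equiv C S P Q \<and> length P \<le> L \<and> length Q \<le> L"
    then have "enat (rewrite_dist C S P Q) \<in> X"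
      unfolding X_def by blast
    then have "enat (rewrite_dist C S P Q) \<le> Sup X"
      by (rule Sup_upper)
    also have "\<dots> \<le> enat D"
      using le X by simp
    finally show "rewrite_dist C S P Q \<le> D"
      by simp
  next
    assume "\<forall>P Q. word_equiv C S P Q \<and> length P \<le> L \<and> length Q \<le> L \<longrightarrow> rewrite_dist C S P Q \<le> D"
    then have "x \<le> enat D" if "x \<in> X" for x
      using that by (auto simp: X_def)
    then show "rewrite_bound C S L \<le> enat D"
      unfolding X by (rule Sup_least)
  qed
qed

lemma (in marked_category) identity_word_of_shape:
  assumes "X \<in> Obj C" "ident C X \<in> S" "\<sigma> \<noteq> []"
  obtains P where "P \<approx> [Fwd (ident C X)]" "shape P = \<sigma>"
proof
  let ?P = "map (map_arrow (\<lambda>_. ident C X)) \<sigma>"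
  have "map_arrow (\<lambda>_. ident C X) c \<in> {Fwd (ident C X), Bwd (ident C X)}" for c :: "unit arrow"
    by (cases c) auto
  then have "set ?P \<subseteq> {Fwd (ident C X), Bwd (ident C X)}"
    unfolding set_map by (rule image_subsetI)
  then show "?P \<approx> [Fwd (ident C X)]"
    by (rule rel_identity_word[OF assms(1,2), rotated]) (simp add: assms(3))
  have "map_arrow (\<lambda>_. ()) c = c" for c :: "unit arrow"
    by (cases c) auto
  then show "shape ?P = \<sigma>"
    unfolding shape_map by (simp add: shape_def map_idI)
qed

text \<open>The two patterns are fixed, so that equivalent pairs of words from any selection of coordinates
  assemble to a pair of words over the product. If no bound off a finite set existed, pairs at
  distance more than \<open>n\<close> could be placed at distinct indices \<open>j n\<close>, while a rewriting of
  the assembled words in some number of steps bounds all these distances.\<close>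

lemma (in marked_family) bound_for_shapes:
  assumes ob: "\<And>i. i \<in> I \<Longrightarrow> Obj (A i) \<noteq> {}"
    and faith: "\<And>P Q. \<lbrakk>P \<in> words M \<Sigma>; Q \<in> words M \<Sigma>;
      \<And>i. i \<in> I \<Longrightarrow> word_equiv (A i) (S i) (proj i P) (proj i Q)\<rbrakk> \<Longrightarrow> word_equiv M \<Sigma> P Q"
    and ne: "\<sigma> \<noteq> []" "\<tau> \<noteq> []"
  shows "\<exists>F D. finite F \<and> F \<subseteq> I \<and> (\<forall>i\<in>I - F. \<forall>P Q. word_equiv (A i) (S i) P Q \<longrightarrow>
    shape P = \<sigma> \<longrightarrow> shape Q = \<tau> \<longrightarrow> rewrite_dist (A i) (S i) P Q \<le> D)"
proof (rule ccontr)
  define far where "far i n \<longleftrightarrow> (\<exists>P Q. word_equiv (A i) (S i) P Q \<and> shape P = \<sigma> \<and> shape Q = \<tau> \<and>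
    n < rewrite_dist (A i) (S i) P Q)" for i n
  assume "\<not> ?thesis"
  then have far: "\<exists>i\<in>I - F. far i n" if "finite F" "F \<subseteq> I" for F n
    using that unfolding far_def by (meson not_le)
  have "\<exists>j. \<forall>n::nat. j n \<in> I - j ` {..<n} \<and> far (j n) n"
  proof (rule dependent_wellorder_choice)
    fix n :: nat and j :: "nat \<Rightarrow> 'i"
    assume "\<And>k. k < n \<Longrightarrow> j k \<in> I - j ` {..<k} \<and> far (j k) k"
    then show "\<exists>i. i \<in> I - j ` {..<n} \<and> far i n"
      using far[of "j ` {..<n}" n] by blast
  next
    fix r :: 'i and f g :: "nat \<Rightarrow> 'i" and x
    assume "\<And>y. y < x \<Longrightarrow> f y = g y"
    then have "f ` {..<x} = g ` {..<x}"
      by (intro image_cong) auto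
    then show "(r \<in> I - f ` {..<x} \<and> far r x) = (r \<in> I - g ` {..<x} \<and> far r x)"
      by simp
  qed
  then obtain j where j: "\<And>n::nat. j n \<in> I" "\<And>n. j n \<notin> j ` {..<n}" "\<And>n. far (j n) n"
    by auto
  have "inj j"
  proof (rule linorder_injI)
    fix k n :: nat assume "k < n"
    then show "j k \<noteq> j n"
      using j(2)[of n] by (metis imageI lessThan_iff)
  qed
  \<comment> \<open>Outside the chosen indices, identity words with the two patterns are used.\<close>
  have "\<forall>i\<in>I. \<exists>P Q. word_equiv (A i) (S i) P Q \<and> shape P = \<sigma> \<and> shape Q = \<tau> \<and>
    (\<forall>n. i = j n \<longrightarrow> n < rewrite_dist (A i) (S i) P Q)"
  proof
    fix i assume i: "i \<in> I"
    show "\<exists>P Q. word_equiv (A i) (S i) P Q \<and> shape P = \<sigma> \<and> shape Q = \<tau> \<and>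
      (\<forall>n. i = j n \<longrightarrow> n < rewrite_dist (A i) (S i) P Q)"
    proof (cases "i \<in> range j")
      case True
      then obtain n where n: "i = j n"
        by auto
      then have "\<forall>k. i = j k \<longrightarrow> k = n"
        using \<open>inj j\<close> by (auto simp: inj_eq)
      then show ?thesis
        using j(3)[of n] n unfolding far_def by metis
    next
      case False
      interpret Ai: marked_category "A i" "S i"
        using i by (rule marked_cat)
      obtain X where X: "X \<in> Obj (A i)"
        using ob[OF i] by auto
      obtain P where P: "Ai.rel P [Fwd (ident (A i) X)]" "shape P = \<sigma>"
        using Ai.identity_word_of_shape[OF X ident_marked[OF i X] ne(1)] .
      obtain Q where Q: "Ai.rel Q [Fwd (ident (A i) X)]" "shape Q = \<tau>"
        using Ai.identity_word_of_shape[OF X ident_marked[OF i X] ne(2)] .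
      show ?thesis
        using P Q False Ai.rel_trans[OF P(1) Ai.rel_sym[OF Q(1)]] by blast
    qed
  qed
  then obtain p q where pq: "\<And>i. i \<in> I \<Longrightarrow> word_equiv (A i) (S i) (p i) (q i) \<and> shape (p i) = \<sigma> \<and>
      shape (q i) = \<tau> \<and> (\<forall>n. i = j n \<longrightarrow> n < rewrite_dist (A i) (S i) (p i) (q i))"
    by metis
  obtain P where P: "P \<in> words M \<Sigma>" "\<And>i. i \<in> I \<Longrightarrow> proj i P = p i"
    using product_word[OF ne(1), of p] pq word_equiv_words by metis
  obtain Q where Q: "Q \<in> words M \<Sigma>" "\<And>i. i \<in> I \<Longrightarrow> proj i Q = q i"
    using product_word[OF ne(2), of q] pq word_equiv_words by metis
  have "word_equiv M \<Sigma> P Q"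
    by (rule faith[OF P(1) Q(1)]) (use P Q pq in simp)
  then obtain n where n: "(rewrite_step M \<Sigma> ^^ n) P Q"
    by (auto simp: word_equiv_iff rtranclp_power)
  have "rewrite_dist (A (j n)) (S (j n)) (p (j n)) (q (j n)) \<le> n"
    using rewrite_dist_le[OF marked_functor.rewrite_steps_map[OF projection[OF j(1)] n]]
      P(2)[OF j(1)] Q(2)[OF j(1)] by simp
  then show False
    using pq[OF j(1)[of n]] by auto
qed

theorem theorem5p3:
  fixes I :: "'i set"
    and A :: "'i \<Rightarrow> ('o, 'm) cat"
    and S :: "'i \<Rightarrow> 'm set"
  assumes "\<And>i. i \<in> I \<Longrightarrow> category (A i)"
    and "\<And>i. i \<in> I \<Longrightarrow> Obj (A i) \<noteq> {}"
    and "\<And>i. i \<in> I \<Longrightarrow> S i \<subseteq> Mor (A i)"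
    and "\<And>i X. \<lbrakk>i \<in> I; X \<in> Obj (A i)\<rbrakk> \<Longrightarrow> ident (A i) X \<in> S i"
  shows "faithful (localization (prod_cat I A) (\<Pi>\<^sub>E i\<in>I. S i)) (theta I A S) \<longleftrightarrow>
    (\<forall>L::nat. \<exists>F D. finite F \<and> F \<subseteq> I \<and>
       (\<forall>i \<in> I - F. rewrite_bound (A i) (S i) L \<le> enat D))"
proof -
  interpret marked_family I A S
  proof (rule marked_family.intro)
    show "marked_category (A i) (S i)" if "i \<in> I" for i
      using assms(1,3)[OF that] by (intro marked_category.intro marked_category_axioms.intro)
    show "ident (A i) X \<in> S i" if "i \<in> I" "X \<in> Obj (A i)" for i X
      using assms(4)[OF that] .
  qed
  show ?thesis
    unfolding faithful_theta_iff
  proof (intro iffI allI ballI impI)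
    fix L :: nat
    assume faith: "\<forall>P\<in>words M \<Sigma>. \<forall>Q\<in>words M \<Sigma>.
      (\<forall>i\<in>I. word_equiv (A i) (S i) (proj i P) (proj i Q)) \<longrightarrow> word_equiv M \<Sigma> P Q"
    let ?K = "{\<sigma> :: unit arrow list. length \<sigma> \<le> L}"
    have "\<forall>s. \<exists>F D. fst s \<noteq> [] \<and> snd s \<noteq> [] \<longrightarrow> finite F \<and> F \<subseteq> I \<and>
      (\<forall>i\<in>I - F. \<forall>P Q. word_equiv (A i) (S i) P Q \<longrightarrow>
        shape P = fst s \<longrightarrow> shape Q = snd s \<longrightarrow> rewrite_dist (A i) (S i) P Q \<le> D)"
    proof
      fix s :: "unit arrow list \<times> unit arrow list"
      show "\<exists>F D. fst s \<noteq> [] \<and> snd s \<noteq> [] \<longrightarrow> finite F \<and> F \<subseteq> I \<and>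
        (\<forall>i\<in>I - F. \<forall>P Q. word_equiv (A i) (S i) P Q \<longrightarrow>
          shape P = fst s \<longrightarrow> shape Q = snd s \<longrightarrow> rewrite_dist (A i) (S i) P Q \<le> D)"
      proof (cases "fst s \<noteq> [] \<and> snd s \<noteq> []")
        case True
        have "\<exists>F D. finite F \<and> F \<subseteq> I \<and> (\<forall>i\<in>I - F. \<forall>P Q. word_equiv (A i) (S i) P Q \<longrightarrow>
          shape P = fst s \<longrightarrow> shape Q = snd s \<longrightarrow> rewrite_dist (A i) (S i) P Q \<le> D)"
        proof (rule bound_for_shapes)
          show "word_equiv M \<Sigma> P Q" if "P \<in> words M \<Sigma>" "Q \<in> words M \<Sigma>"
            "\<And>i. i \<in> I \<Longrightarrow> word_equiv (A i) (S i) (proj i P) (proj i Q)" for P Q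
            using faith that by blast
        qed (use True assms(2) in auto)
        then show ?thesis
          by blast
      qed blast
    qed
    then obtain F D where FD: "\<And>s. fst s \<noteq> [] \<and> snd s \<noteq> [] \<Longrightarrow> finite (F s) \<and> F s \<subseteq> I \<and>
      (\<forall>i\<in>I - F s. \<forall>P Q. word_equiv (A i) (S i) P Q \<longrightarrow>
        shape P = fst s \<longrightarrow> shape Q = snd s \<longrightarrow> rewrite_dist (A i) (S i) P Q \<le> D s)"
      by metis
    \<comment> \<open>There is one bound for each of finitely many pairs of patterns; these are added up.\<close>
    define T where "T = {s \<in> ?K \<times> ?K. fst s \<noteq> [] \<and> snd s \<noteq> []}"
    have T: "finite T"
      using finite_shapes[of L] by (simp add: T_def)
    have "rewrite_dist (A i) (S i) P Q \<le> sum D T"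
      if i: "i \<in> I - \<Union> (F ` T)" and e: "word_equiv (A i) (S i) P Q" "length P \<le> L" "length Q \<le> L"
      for i P Q
    proof -
      have s: "(shape P, shape Q) \<in> T"
        using e words_nonempty[OF word_equiv_words(1)[OF e(1)]]
          words_nonempty[OF word_equiv_words(2)[OF e(1)]] by (simp add: T_def)
      then have "i \<in> I - F (shape P, shape Q)"
        using i by blast
      then have "rewrite_dist (A i) (S i) P Q \<le> D (shape P, shape Q)"
        using FD[of "(shape P, shape Q)"] s e(1) by (simp add: T_def)
      also have "\<dots> \<le> sum D T"
        using s T by (simp add: member_le_sum)
      finally show ?thesis .
    qed
    moreover have "finite (\<Union> (F ` T))" "\<Union> (F ` T) \<subseteq> I"
      using FD T by (auto simp: T_def)
    ultimately show "\<exists>F D. finite F \<and> F \<subseteq> I \<and> (\<forall>i \<in> I - F. rewrite_bound (A i) (S i) L \<le> enat D)"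
      unfolding rewrite_bound_le_iff by blast
  next
    fix P Q assume PQ: "P \<in> words M \<Sigma>" "Q \<in> words M \<Sigma>"
      and e: "\<forall>i\<in>I. word_equiv (A i) (S i) (proj i P) (proj i Q)"
    assume "\<forall>L::nat. \<exists>F D. finite F \<and> F \<subseteq> I \<and> (\<forall>i \<in> I - F. rewrite_bound (A i) (S i) L \<le> enat D)"
    then obtain F D where F: "finite F" "F \<subseteq> I"
      and D: "\<And>i. i \<in> I - F \<Longrightarrow> rewrite_bound (A i) (S i) (max (length P) (length Q)) \<le> enat D"
      by metis
    \<comment> \<open>The finitely many exceptional indices only contribute finitely many further distances.\<close>
    let ?d = "\<lambda>i. rewrite_dist (A i) (S i) (proj i P) (proj i Q)"
    have "?d i \<le> D + sum ?d F" if i: "i \<in> I" for i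
    proof (cases "i \<in> F")
      case True
      then have "?d i \<le> sum ?d F"
        by (intro member_le_sum) (use F(1) in auto)
      then show ?thesis
        by linarith
    next
      case False
      then show ?thesis
        using D[of i] i e unfolding rewrite_bound_le_iff by (auto intro: trans_le_add1)
    qed
    then show "word_equiv M \<Sigma> P Q"
      by (intro rel_if_bounded[OF marked_family_axioms PQ, of "D + sum ?d F"])
        (use rewrite_dist_steps e in blast)
  qed
qed

end
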